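(* $\mathrm{Fin}(10)=\mathrm{Adm}(10)\setminus\{(1,8),(3,1),(3,5),(4,1),(4,3),(5,1),(5,2)\}$.
   Context: $K_4-e$ is the graph on four vertices $a,b,c,d$ with edges $ab,ac,ad,bc,bd$; it is denoted $[a,b,c-d]$. A $(K_4-e)$-design of order $v$ is a pair $(X,\mathcal B)$ where $X$ is a set of $v$ vertices and $\mathcal B$ is a collection of copies of $K_4-e$ (blocks) with vertices in $X$ whose edge sets partition the edges of $K_v$ on $X$; it has $b_v=v(v-1)/10$ blocks. For a graph $B$, $T(B)$ is the set of its triangles (3-vertex subsets inducing a triangle); e.g. $T([a,b,c-d])=\{\{a,b,c\},\{a,b,d\}\}$, and $T(\mathcal B)=\bigcup_{B\in\mathcal B}T(B)$. Two designs $(X,\mathcal B_1),(X,\mathcal B_2)$ on the same vertex set intersect in $s$ blocks if $|\mathcal B_1\cap\mathcal B_2|=s$, and in $t$ triangles if $|T(\mathcal B_1)\cap T(\mathcal B_2)|=t$. Define $\mathrm{Fin}(v)=\{(s,t):$ there exists a pair of $(K_4-e)$-designs of order $v$ on the same vertex set intersecting in $s$ blocks and $t+2s$ triangles$\}$; $J(v)=\{s:$ there is a pair of $(K_4-e)$-designs of order $v$ intersecting in $s$ blocks$\}$; $J_T(v)=\{t:$ there is a pair of $(K_4-e)$-designs of order $v$ intersecting in $t$ triangles$\}$; and $\mathrm{Adm}(v)=\{(s,t): s,t\ge 0,\ s+t\le b_v,\ s\in J(v),\ t+2s\in J_T(v)\}$. (Known from the literature: $J(10)=\{0,1,\dots,6,9\}$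 and $J_T(10)=\{0,1,\dots,12,14,15,18\}$.) *)

theory Defs
  imports Main
begin

text \<open>Graphs are represented by their edge sets (sets of 2-element vertex sets).
  The block [a,b,c-d] (K4 minus the edge cd) has edges ab, ac, ad, bc, bd.\<close>

definition kblock :: "'a \<Rightarrow> 'a \<Rightarrow> 'a \<Rightarrow> 'a \<Rightarrow> 'a set set" where
  "kblock a b c d = {{a,b},{a,c},{a,d},{b,c},{b,d}}"

definition is_block :: "'a set set \<Rightarrow> bool" where
  "is_block B \<longleftrightarrow> (\<exists>a b c d. distinct [a,b,c,d] \<and> B = kblock a b c d)"

definition k4e_design :: "'a set \<Rightarrow> 'a set set set \<Rightarrow> bool" where
  "k4e_design X \<B> \<longleftrightarrow>
     (\<forall>B\<in>\<B>. is_block B \<and> \<Union>B \<subseteq> X) \<and>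
     (\<forall>x\<in>X. \<forall>y\<in>X. x \<noteq> y \<longrightarrow> (\<exists>!B. B \<in> \<B> \<and> {x,y} \<in> B))"

definition tri :: "'a set set \<Rightarrow> 'a set set" where
  "tri B = {t. card t = 3 \<and> (\<forall>x\<in>t. \<forall>y\<in>t. x \<noteq> y \<longrightarrow> {x,y} \<in> B)}"

definition tris :: "'a set set set \<Rightarrow> 'a set set" where
  "tris \<B> = (\<Union>B\<in>\<B>. tri B)"

definition bnum :: "nat \<Rightarrow> nat" where
  "bnum v = v * (v - 1) div 10"

definition Fin :: "nat \<Rightarrow> (nat \<times> nat) set" where
  "Fin v = {(s,t). \<exists>(X::nat set) B1 B2. finite X \<and> card X = v \<and>
      k4e_design X B1 \<and> k4e_design X B2 \<and>
      card (B1 \<inter> B2) = s \<and> card (tris B1 \<inter> tris B2) = t + 2*s}"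

definition J :: "nat \<Rightarrow> nat set" where
  "J v = {s. \<exists>(X::nat set) B1 B2. finite X \<and> card X = v \<and>
      k4e_design X B1 \<and> k4e_design X B2 \<and> card (B1 \<inter> B2) = s}"

definition JT :: "nat \<Rightarrow> nat set" where
  "JT v = {t. \<exists>(X::nat set) B1 B2. finite X \<and> card X = v \<and>
      k4e_design X B1 \<and> k4e_design X B2 \<and> card (tris B1 \<inter> tris B2) = t}"

definition Adm :: "nat \<Rightarrow> (nat \<times> nat) set" where
  "Adm v = {(s,t). s + t \<le> bnum v \<and> s \<in> J v \<and> t + 2*s \<in> JT v}"

end

theory Submission
  imports Defs
begin

text \<open>Every design of order 10 has a rigid shape. If a vertex has degree 3 in \<open>c\<close> blocks and
  degree 2 in \<open>w\<close> blocks, then \<open>3c + 2w = 9\<close>, so \<open>c\<close> is 3 or 1; since the nine blocks have 18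
  vertices of degree 3, exactly four vertices (the core) have \<open>c = 3\<close>. Core vertices are never of
  degree 2, so the six edges of the core are the central edges of six blocks, and opposite core
  edges \<open>ab\<close>, \<open>cd\<close> carry the same pair of outer vertices; the three pairs \<open>P\<close>, \<open>Q\<close>, \<open>R\<close> partition the
  six outer vertices. The remaining three blocks decompose the outer \<open>K\<^sub>6\<close> and are
  \<open>[M-N]\<close>, \<open>[N-K]\<close>, \<open>[K-M]\<close> for a second partition into pairs, where \<open>[e-p]\<close> has central edge
  \<open>e\<close> and missing edge \<open>p\<close>. Depending on how the two partitions meet there are three designs up to
  isomorphism.

  A block of one design lies in the other design iff both of its triangles are triangles of the
  other one. Hence \<open>s\<close> and \<open>t\<close> are the numbers of blocks of the second design with both, respectively
  exactly one, of their triangles in the first, and the pair \<open>(s, t)\<close> splits as a sum over the six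
  core blocks and the three outer blocks. Fixing the core of the second design, the two summands
  vary independently, so \<open>3 * 210 * (90 + 30)\<close> partial designs decide which pairs occur. This
  gives 40 pairs, and \<open>J(10)\<close>, \<open>J\<^sub>T(10)\<close> and \<open>Adm(10)\<close> are read off from them.\<close>

section \<open>Shape of a design of order 10\<close>

text \<open>Two unordered pairs, the central edge and the missing edge, absorb the symmetries of
  \<open>kblock\<close> under exchanging \<open>a\<close> with \<open>b\<close> or \<open>c\<close>
  with \<open>d\<close>.\<close>

definition kgraph :: "'a set \<Rightarrow> 'a set \<Rightarrow> 'a set set" where
  "kgraph e p = insert e {{x, y} | x y. x \<in> e \<and> y \<in> p}"

lemma kblock_eq_kgraph: "kblock a b c d = kgraph {a,b} {c,d}"
  unfolding kblock_def kgraph_def by auto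

lemma edge_in_kgraph_iff:
  assumes "card e = 2" "card p = 2" "e \<inter> p = {}" "x \<noteq> y"
  shows "{x, y} \<in> kgraph e p \<longleftrightarrow> x \<in> e \<and> y \<in> e \<or> x \<in> e \<and> y \<in> p \<or> x \<in> p \<and> y \<in> e"
  using assms unfolding kgraph_def by (auto simp: card_2_iff doubleton_eq_iff)

lemma pair_set_eqI: "card e = 2 \<Longrightarrow> x \<in> e \<Longrightarrow> y \<in> e \<Longrightarrow> x \<noteq> y \<Longrightarrow> e = {x, y}"
  by (auto simp: card_2_iff)

lemma is_block_iff_kgraph:
  "is_block B \<longleftrightarrow> (\<exists>e p. card e = 2 \<and> card p = 2 \<and> e \<inter> p = {} \<and> B = kgraph e p)"
proof
  assume "is_block B"
  then obtain a b c d where "distinct [a,b,c,d]" "B = kgraph {a,b} {c,d}"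
    unfolding is_block_def kblock_eq_kgraph by blast
  then show "\<exists>e p. card e = 2 \<and> card p = 2 \<and> e \<inter> p = {} \<and> B = kgraph e p"
    by (intro exI[of _ "{a,b}"] exI[of _ "{c,d}"]) auto
next
  assume "\<exists>e p. card e = 2 \<and> card p = 2 \<and> e \<inter> p = {} \<and> B = kgraph e p"
  then obtain a b c d where "a \<noteq> b" "c \<noteq> d" "{a,b} \<inter> {c,d} = {}" "B = kgraph {a,b} {c,d}"
    by (auto simp: card_2_iff)
  then show "is_block B"
    unfolding is_block_def kblock_eq_kgraph
    by (intro exI[of _ a] exI[of _ b] exI[of _ c] exI[of _ d]) auto
qed

lemma Union_kgraph: "card e = 2 \<Longrightarrow> \<Union>(kgraph e p) = e \<union> p"
  unfolding kgraph_def by (auto simp: card_2_iff)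

lemma design_edge_unique:
  assumes "k4e_design X D" "B \<in> D" "B' \<in> D" "x \<noteq> y" "{x, y} \<in> B" "{x, y} \<in> B'"
  shows "B = B'"
proof -
  have "x \<in> X" "y \<in> X" using assms unfolding k4e_design_def by blast+
  then have "\<exists>!B. B \<in> D \<and> {x,y} \<in> B" using assms unfolding k4e_design_def by auto
  then show ?thesis using assms by blast
qed

lemma finite_design:
  assumes "k4e_design X D" "finite X" shows "finite D"
proof (rule finite_subset)
  show "D \<subseteq> Pow (Pow X)" using assms unfolding k4e_design_def by auto
qed (use assms in simp)

locale design10 =
  fixes X :: "'a set" and D :: "'a set set set"
  assumes finite_X: "finite X" and card_X: "card X = 10" and design: "k4e_design X D"
begin

text \<open>An arbitrary decomposition is chosen; that a block determines both pairs is proved as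
  \<open>parts_eq\<close> inside \<open>design_structure\<close>, where explicit blocks
  appear.\<close>

definition parts :: "'a set set \<Rightarrow> 'a set \<times> 'a set" where
  "parts B = (SOME (e, p). card e = 2 \<and> card p = 2 \<and> e \<inter> p = {} \<and> B = kgraph e p)"

definition cen :: "'a set set \<Rightarrow> 'a set" where "cen B = fst (parts B)"
definition wing :: "'a set set \<Rightarrow> 'a set" where "wing B = snd (parts B)"

lemma block_parts:
  assumes "B \<in> D"
  shows "card (cen B) = 2" "card (wing B) = 2" "cen B \<inter> wing B = {}"
    and block_eq: "B = kgraph (cen B) (wing B)"
    and cen_sub: "cen B \<subseteq> X" and wing_sub: "wing B \<subseteq> X"
proof -
  have "is_block B" "\<Union>B \<subseteq> X" using design assms unfolding k4e_design_def by auto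
  then have "\<exists>z. case z of (e, p) \<Rightarrow> card e = 2 \<and> card p = 2 \<and> e \<inter> p = {} \<and> B = kgraph e p"
    unfolding is_block_iff_kgraph by auto
  from someI_ex[OF this] have *: "case parts B of (e, p) \<Rightarrow> card e = 2 \<and> card p = 2 \<and> e \<inter> p = {} \<and> B = kgraph e p"
    unfolding parts_def .
  then show h: "card (cen B) = 2" "card (wing B) = 2" "cen B \<inter> wing B = {}" "B = kgraph (cen B) (wing B)"
    unfolding cen_def wing_def by auto
  with Union_kgraph[of "cen B" "wing B"] \<open>\<Union>B \<subseteq> X\<close> show "cen B \<subseteq> X" "wing B \<subseteq> X" by auto
qed

lemma edge_iff:
  assumes "B \<in> D" "x \<noteq> y"
  shows "{x, y} \<in> B \<longleftrightarrow> x \<in> cen B \<and> y \<in> cen B \<or> x \<in> cen B \<and> y \<in> wing B \<or> x \<in> wing B \<and> y \<in> cen B"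
  using edge_in_kgraph_iff[OF block_parts(1-3)[OF assms(1)] assms(2)] block_eq[OF assms(1)] by simp

lemmas edge_unique = design_edge_unique[OF design]

definition blk :: "'a \<Rightarrow> 'a \<Rightarrow> 'a set set" where
  "blk x y = (THE B. B \<in> D \<and> {x, y} \<in> B)"

lemma blk:
  assumes "x \<in> X" "y \<in> X" "x \<noteq> y"
  shows "blk x y \<in> D" "{x, y} \<in> blk x y"
proof -
  have "\<exists>!B. B \<in> D \<and> {x,y} \<in> B"
    using design assms unfolding k4e_design_def by auto
  from theI'[OF this] show "blk x y \<in> D" "{x, y} \<in> blk x y"
    unfolding blk_def by auto
qed

lemma blk_commute: "blk x y = blk y x"
  unfolding blk_def by (simp add: insert_commute)

lemmas finite_D = finite_design[OF design finite_X]

section \<open>Degree counting: nine blocks and four core vertices\<close>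

definition ncen :: "'a \<Rightarrow> nat" where "ncen x = card {B \<in> D. x \<in> cen B}"
definition nwing :: "'a \<Rightarrow> nat" where "nwing x = card {B \<in> D. x \<in> wing B}"

text \<open>The blocks through \<open>x\<close> partition its nine neighbours: a block contributes
  three of them if \<open>x\<close> is on its central edge and two if \<open>x\<close> is on its
  missing edge.\<close>

lemma degree:
  assumes "x \<in> X"
  shows "3 * ncen x + 2 * nwing x = 9"
proof -
  let ?N = "\<lambda>B. {y. y \<noteq> x \<and> {x, y} \<in> B}"
  have cardN: "card (?N B) = 3 * of_bool (x \<in> cen B) + 2 * of_bool (x \<in> wing B)"
    and finN: "finite (?N B)" if "B \<in> D" for B
  proof -
    note p = block_parts(1-3)[OF that]
    have "y \<noteq> x \<and> {x, y} \<in> B \<longleftrightarrow> y \<noteq> x \<and> (x \<in> cen B \<and> y \<in> cen B \<or> x \<in> cen B \<and> y \<in> wing B \<or> x \<in> wing B \<and> y \<in> cen B)" for y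
      using edge_iff[OF that, of x y] by auto
    then have N: "?N B = (if x \<in> cen B then (cen B - {x}) \<union> wing B else if x \<in> wing B then cen B else {})"
      using p(3) by auto
    have fin: "finite (cen B)" "finite (wing B)"
      using p by (auto intro: card_ge_0_finite)
    show "finite (?N B)" using fin N by auto
    have "card ((cen B - {x}) \<union> wing B) = 3" if "x \<in> cen B"
      using p fin that by (subst card_Un_disjoint) auto
    then show "card (?N B) = 3 * of_bool (x \<in> cen B) + 2 * of_bool (x \<in> wing B)"
      using N p by auto
  qed
  have "X - {x} = (\<Union>B\<in>D. ?N B)"
  proof (intro set_eqI iffI)
    fix y assume "y \<in> X - {x}"
    then show "y \<in> (\<Union>B\<in>D. ?N B)" using blk[of x y] assms by auto
  next
    fix y assume "y \<in> (\<Union>B\<in>D. ?N B)"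
    then show "y \<in> X - {x}" using design unfolding k4e_design_def by blast
  qed
  moreover have "card (X - {x}) = 9" using card_X finite_X assms by simp
  ultimately have "9 = card (\<Union>B\<in>D. ?N B)" by simp
  also have "\<dots> = (\<Sum>B\<in>D. card (?N B))"
  proof (rule card_UN_disjoint)
    show "\<forall>i\<in>D. \<forall>j\<in>D. i \<noteq> j \<longrightarrow> ?N i \<inter> ?N j = {}"
    proof (intro ballI impI equals0I)
      fix i j y assume "i \<in> D" "j \<in> D" "i \<noteq> j" "y \<in> ?N i \<inter> ?N j"
      then show False using edge_unique[of i j x y] by auto
    qed
  qed (use finite_D finN in auto)
  also have "\<dots> = (\<Sum>B\<in>D. 3 * of_bool (x \<in> cen B) + 2 * of_bool (x \<in> wing B))"
    by (rule sum.cong) (use cardN in auto)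
  also have "\<dots> = 3 * ncen x + 2 * nwing x"
    unfolding ncen_def nwing_def
    using finite_D by (simp add: sum.distrib sum_distrib_left [symmetric] of_bool_def sum.If_cases Int_def)
  finally show ?thesis by simp
qed

text \<open>Double counting of incidences. With \<open>cen\<close> and \<open>wing\<close> for
  \<open>F\<close> and \<open>k = 2\<close> it gives both vertex sums below.\<close>

lemma sum_indicator:
  assumes "\<And>B. B \<in> D \<Longrightarrow> F B \<subseteq> X \<and> card (F B) = k"
  shows "(\<Sum>x\<in>X. card {B \<in> D. x \<in> F B}) = k * card D"
proof -
  have "(\<Sum>x\<in>X. card {B \<in> D. x \<in> F B}) = (\<Sum>x\<in>X. \<Sum>B\<in>D. of_bool (x \<in> F B))"
    using finite_D by (simp add: of_bool_def sum.If_cases Int_def)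
  also have "\<dots> = (\<Sum>B\<in>D. \<Sum>x\<in>X. of_bool (x \<in> F B))" by (rule sum.swap)
  also have "\<dots> = (\<Sum>B\<in>D. k)"
  proof (rule sum.cong)
    fix B assume "B \<in> D"
    then have "F B = {x \<in> X. x \<in> F B}" "card (F B) = k" using assms by auto
    then show "(\<Sum>x\<in>X. of_bool (x \<in> F B)) = k"
      using finite_X by (simp add: of_bool_def sum.If_cases Int_def)
  qed simp
  finally show ?thesis by simp
qed

lemma sum_ncen: "(\<Sum>x\<in>X. ncen x) = 2 * card D" and sum_nwing: "(\<Sum>x\<in>X. nwing x) = 2 * card D"
  unfolding ncen_def nwing_def by (intro sum_indicator conjI cen_sub wing_sub block_parts; assumption)+

lemma card_D: "card D = 9"
proof -
  \<comment> \<open>Summing \<open>degree\<close> over ten vertices gives 90, while each block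
    contributes 3 * 2 + 2 * 2 = 10.\<close>
  have "90 = (\<Sum>x\<in>X. 3 * ncen x + 2 * nwing x)"
    using degree card_X by simp
  also have "\<dots> = 10 * card D"
    by (simp add: sum.distrib flip: sum_distrib_left) (simp add: sum_ncen sum_nwing)
  finally show ?thesis by simp
qed

definition core :: "'a set" where "core = {x \<in> X. ncen x = 3}"

lemma core_sub: "core \<subseteq> X" unfolding core_def by auto

text \<open>Since 9 is odd, \<open>ncen x\<close> is odd, and it is at most 3.\<close>

lemma ncen_cases:
  assumes "x \<in> X"
  shows "ncen x = 3 \<and> nwing x = 0 \<or> ncen x = 1 \<and> nwing x = 3"
  using degree[OF assms] by presburger

lemma card_core: "card core = 4"
proof -
  have "18 = (\<Sum>x\<in>X. ncen x)" using sum_ncen card_D by simp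
  \<comment> \<open>Every vertex counts once and a core vertex twice more, so 18 - 10 is twice the
    size of the core.\<close>
  also have "\<dots> = (\<Sum>x\<in>X. 1 + 2 * of_bool (x \<in> core))"
    by (rule sum.cong) (use ncen_cases core_def in auto)
  also have "\<dots> = 10 + 2 * card (X \<inter> core)"
    using finite_X card_X
    by (simp only: sum.distrib flip: sum_distrib_left) (simp add: of_bool_def sum.If_cases)
  finally show ?thesis using core_sub by (simp add: Int_absorb1)
qed

lemma finite_core: "finite core" using finite_X core_sub by (rule finite_subset[rotated])

lemma wing_core:
  assumes "B \<in> D" shows "wing B \<inter> core = {}"
proof (rule ccontr)
  assume "wing B \<inter> core \<noteq> {}"
  then obtain a where a: "a \<in> core" "a \<in> wing B" by auto
  then have "nwing a = 0" using ncen_cases[of a] unfolding core_def by auto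
  then have "{B \<in> D. a \<in> wing B} = {}" unfolding nwing_def using finite_D by simp
  then show False using a assms by auto
qed

text \<open>A core vertex is never an end of a missing edge, so both ends of an edge inside the core
  are central in its block.\<close>

lemma cen_blk:
  assumes "a \<in> core" "b \<in> core" "a \<noteq> b"
  shows "blk a b \<in> D" "cen (blk a b) = {a, b}"
proof -
  have X: "a \<in> X" "b \<in> X" using assms core_sub by auto
  show D: "blk a b \<in> D" using blk(1)[OF X assms(3)] .
  have "a \<in> cen (blk a b)" "b \<in> cen (blk a b)"
    using blk(2)[OF X assms(3)] wing_core[OF D] assms by (auto simp: edge_iff[OF D])
  then show "cen (blk a b) = {a, b}"
    using block_parts(1)[OF D] assms(3) by (intro pair_set_eqI) auto
qed

text \<open>The edges from \<open>a\<close> to the three other core vertices are central edges of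
  three different blocks, and \<open>ncen a = 3\<close> leaves no room for another one.\<close>

lemma cen_core:
  assumes "a \<in> core" "B \<in> D" "a \<in> cen B"
  shows "\<exists>b\<in>core. b \<noteq> a \<and> B = blk a b"
proof -
  have inj: "inj_on (blk a) (core - {a})"
  proof (rule inj_onI)
    fix x y assume "x \<in> core - {a}" "y \<in> core - {a}" "blk a x = blk a y"
    then have "{a, x} = {a, y}" using cen_blk(2)[of a x] cen_blk(2)[of a y] assms(1) by auto
    then show "x = y" by (auto simp: doubleton_eq_iff)
  qed
  have "blk a ` (core - {a}) = {B \<in> D. a \<in> cen B}"
  proof (rule card_subset_eq)
    show "finite {B \<in> D. a \<in> cen B}" using finite_D by simp
    show "blk a ` (core - {a}) \<subseteq> {B \<in> D. a \<in> cen B}" using cen_blk assms(1) by auto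
    have "card (blk a ` (core - {a})) = 3"
      using card_image[OF inj] card_core finite_core assms(1) by simp
    then show "card (blk a ` (core - {a})) = card {B \<in> D. a \<in> cen B}"
      using assms(1) unfolding core_def ncen_def by auto
  qed
  then show ?thesis using assms by auto
qed

lemma cen_sub_core: "a \<in> core \<Longrightarrow> B \<in> D \<Longrightarrow> a \<in> cen B \<Longrightarrow> cen B \<subseteq> core"
  using cen_core cen_blk by (metis empty_subsetI insert_subset)

section \<open>Outer pairs carried by the core edges\<close>

definition pw :: "'a \<Rightarrow> 'a \<Rightarrow> 'a set" where "pw a b = wing (blk a b)"

lemma pw_commute: "pw a b = pw b a" unfolding pw_def by (simp add: blk_commute)

lemma pw_props:
  assumes "a \<in> core" "b \<in> core" "a \<noteq> b"
  shows "pw a b \<subseteq> X - core" "card (pw a b) = 2" "kgraph {a, b} (pw a b) \<in> D" "blk a b = kgraph {a, b} (pw a b)"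
  using cen_blk[OF assms] wing_sub wing_core block_parts(2) block_eq unfolding pw_def
  by (blast, blast, metis+)

text \<open>In the block of the edge \<open>ax\<close> the core vertex \<open>a\<close> must be
  central; the central edge then lies in the core, which puts \<open>x\<close> on the missing
  edge.\<close>

lemma pw_ex:
  assumes "a \<in> core" "x \<in> X - core"
  shows "\<exists>b\<in>core. b \<noteq> a \<and> x \<in> pw a b"
proof -
  have X: "a \<in> X" "x \<in> X" "a \<noteq> x" using assms core_sub by auto
  note B = blk[OF X]
  have a: "a \<in> cen (blk a x)"
    using B(2) wing_core[OF B(1)] assms(1) X by (auto simp: edge_iff[OF B(1) X(3)])
  then have "cen (blk a x) \<subseteq> core" using cen_sub_core assms(1) B(1) by blast
  then have "x \<in> wing (blk a x)"
    using B(2) assms(2) by (auto simp: edge_iff[OF B(1) X(3)])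
  then show ?thesis using cen_core[OF assms(1) B(1) a] unfolding pw_def by auto
qed

text \<open>The edge \<open>ax\<close> belongs to only one block. Together with
  \<open>pw_ex\<close>, the three pairs at \<open>a\<close> partition the outer vertices.\<close>

lemma pw_unique:
  assumes "a \<in> core" "b \<in> core" "c \<in> core" "a \<noteq> b" "a \<noteq> c" "x \<in> pw a b" "x \<in> pw a c"
  shows "b = c"
proof -
  have ax: "a \<noteq> x" using pw_props(1)[of a b] assms by auto
  have "{a, x} \<in> blk a b" "{a, x} \<in> blk a c"
    using assms cen_blk[of a b] cen_blk[of a c] unfolding pw_def
    by (auto simp: edge_iff[OF _ ax])
  then have "blk a b = blk a c" using edge_unique cen_blk(1) assms ax by blast
  then have "{a, b} = {a, c}" using cen_blk(2) assms by metis
  then show ?thesis by (auto simp: doubleton_eq_iff)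
qed

text \<open>A point \<open>x\<close> of \<open>pw a b\<close> lies in one of the pairs at
  \<open>c\<close>. The pairs \<open>pw c a\<close> and \<open>pw c b\<close> are excluded, because
  at \<open>a\<close> and at \<open>b\<close> the point already occurs in \<open>pw a b\<close>.
  This leaves \<open>pw c d\<close>.\<close>

lemma pw_opposite:
  assumes "core = {a, b, c, d}" "distinct [a, b, c, d]"
  shows "pw a b = pw c d"
proof (rule card_subset_eq)
  show "finite (pw c d)" "card (pw a b) = card (pw c d)"
    using pw_props(2)[of c d] pw_props(2)[of a b] assms by (auto intro: card_ge_0_finite)
  show "pw a b \<subseteq> pw c d"
  proof
    fix x assume x: "x \<in> pw a b"
    then have "x \<in> X - core" using pw_props(1)[of a b] assms by auto
    then obtain r where r: "r \<in> core" "r \<noteq> c" "x \<in> pw c r" using pw_ex[of c x] assms by auto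
    have "r \<noteq> a" using pw_unique[of a b c x] x r(3) assms by (auto simp: pw_commute)
    moreover have "r \<noteq> b" using pw_unique[of b a c x] x r(3) assms by (auto simp: pw_commute)
    ultimately show "x \<in> pw c d" using r assms by auto
  qed
qed

lemma pw_Un:
  assumes "core = {a, b, c, d}" "distinct [a, b, c, d]"
  shows "pw a b \<union> pw a c \<union> pw a d = X - core"
  using pw_ex[of a] pw_props(1)[of a b] pw_props(1)[of a c] pw_props(1)[of a d] assms by auto

text \<open>Of the three blocks with \<open>x\<close> on the missing edge, exactly two have their
  central edge in the core, namely those of the two opposite core edges that carry
  \<open>x\<close>.\<close>

lemma nwing_outer:
  assumes "x \<in> X - core"
  shows "card {B \<in> D. x \<in> wing B \<and> cen B \<inter> core = {}} = 1"
proof -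
  obtain a where a: "a \<in> core" using card_core by fastforce
  obtain b where b: "b \<in> core" "b \<noteq> a" "x \<in> pw a b" using pw_ex[OF a assms] by auto
  have "card (core - {a, b}) = 2" using card_core finite_core a b by simp
  then obtain c d where cd: "core - {a, b} = {c, d}" "c \<noteq> d" by (auto simp: card_2_iff)
  then have A: "core = {a, b, c, d}" "distinct [a, b, c, d]" using a b by auto
  have xcd: "x \<in> pw c d" using pw_opposite[OF A] b(3) by simp
  note ab = cen_blk[OF a b(1) b(2)[symmetric]]
  have cdD: "blk c d \<in> D" "cen (blk c d) = {c, d}" using cen_blk[of c d] A by auto
  \<comment> \<open>If a core vertex \<open>u\<close> is central in \<open>B\<close>, the edge
    \<open>ux\<close> is already covered by \<open>blk a b\<close> or \<open>blk c d\<close>, whose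
    central edges exhaust the core.\<close>
  have "{B \<in> D. x \<in> wing B \<and> cen B \<inter> core \<noteq> {}} = {blk a b, blk c d}"
  proof (intro equalityI subsetI)
    fix B assume "B \<in> {B \<in> D. x \<in> wing B \<and> cen B \<inter> core \<noteq> {}}"
    then obtain u where u: "B \<in> D" "x \<in> wing B" "u \<in> cen B" "u \<in> core" by auto
    then have ux: "u \<noteq> x" using assms by auto
    have "{u, x} \<in> B" using u ux by (auto simp: edge_iff)
    moreover have "{u, x} \<in> blk a b \<or> {u, x} \<in> blk c d"
      using u(4) ux ab cdD b(3) xcd A(1) unfolding pw_def by (auto simp: edge_iff)
    ultimately show "B \<in> {blk a b, blk c d}"
      using edge_unique[OF u(1) _ ux] ab(1) cdD(1) by blast
  next
    fix B assume "B \<in> {blk a b, blk c d}"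
    then show "B \<in> {B \<in> D. x \<in> wing B \<and> cen B \<inter> core \<noteq> {}}"
      using ab cdD b(3) xcd A unfolding pw_def by auto
  qed
  moreover have "blk a b \<noteq> blk c d" using ab cdD A by auto
  ultimately have "card {B \<in> D. x \<in> wing B \<and> cen B \<inter> core \<noteq> {}} = 2" by simp
  moreover have "card {B \<in> D. x \<in> wing B} = 3"
    using ncen_cases[of x] assms unfolding core_def nwing_def by auto
  moreover have "{B \<in> D. x \<in> wing B} =
      {B \<in> D. x \<in> wing B \<and> cen B \<inter> core = {}} \<union> {B \<in> D. x \<in> wing B \<and> cen B \<inter> core \<noteq> {}}" by auto
  moreover have "card \<dots> = card {B \<in> D. x \<in> wing B \<and> cen B \<inter> core = {}} + card {B \<in> D. x \<in> wing B \<and> cen B \<inter> core \<noteq> {}}"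
    using finite_D by (intro card_Un_disjoint) auto
  ultimately show ?thesis by simp
qed

lemma cen_outer:
  assumes "B \<in> D" "B' \<in> D" "x \<in> X - core" "x \<in> cen B" "x \<in> cen B'"
  shows "B = B'"
proof -
  have "card {B \<in> D. x \<in> cen B} = 1"
    using ncen_cases[of x] assms unfolding core_def ncen_def by auto
  then obtain C where "{B \<in> D. x \<in> cen B} = {C}" by (auto simp: card_1_singleton_iff)
  then show ?thesis using assms by blast
qed

lemma card_outer: "card (X - core) = 6"
  using card_Diff_subset[OF finite_core core_sub] card_X card_core by simp

lemma outer_third:
  assumes "B \<in> D" "cen B \<inter> core = {}"
  shows "card (X - core - cen B - wing B) = 2"
proof -
  note p = block_parts(1-3)[OF assms(1)]
  have fin: "finite (cen B)" "finite (wing B)" using p by (auto intro: card_ge_0_finite)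
  have "card (cen B \<union> wing B) = 4" using p fin by (subst card_Un_disjoint) auto
  moreover have "cen B \<union> wing B \<subseteq> X - core"
    using cen_sub[OF assms(1)] wing_sub[OF assms(1)] wing_core[OF assms(1)] assms(2) by auto
  moreover have "X - core - cen B - wing B = X - core - (cen B \<union> wing B)" by auto
  ultimately show ?thesis using card_outer fin by (simp add: card_Diff_subset)
qed

text \<open>Iterating this step twice closes up the cyclic triple of outer blocks.\<close>

lemma outer_step:
  assumes "B \<in> D" "cen B \<inter> core = {}"
  shows "kgraph (X - core - cen B - wing B) (cen B) \<in> D"
proof -
  define k where "k = X - core - cen B - wing B"
  note p = block_parts(1-3)[OF assms(1)]
  have cardk: "card k = 2" using outer_third[OF assms] unfolding k_def .
  \<comment> \<open>Both edges from \<open>x\<close> to \<open>k\<close> lie in outer blocks with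
    \<open>x\<close> on the missing edge, since \<open>B\<close> is the only block with
    \<open>x\<close> central and it misses \<open>k\<close>. By \<open>nwing_outer\<close> this is
    one block, so its central edge is all of \<open>k\<close>.\<close>
  have key: "\<exists>C\<in>D. cen C = k \<and> x \<in> wing C" if x: "x \<in> cen B" for x
  proof -
    have xX: "x \<in> X - core" using x assms cen_sub by blast
    have *: "blk x y \<in> D \<and> x \<in> wing (blk x y) \<and> y \<in> cen (blk x y) \<and> cen (blk x y) \<inter> core = {}" if y: "y \<in> k" for y
    proof -
      have yX: "y \<in> X - core" and xy: "x \<noteq> y" using y x unfolding k_def by auto
      have C: "blk x y \<in> D" "{x, y} \<in> blk x y" using blk[of x y] xX yX xy by auto
      have nx: "x \<notin> cen (blk x y)"
      proof
        assume "x \<in> cen (blk x y)"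
        then have "blk x y = B" using cen_outer C(1) assms(1) xX x by blast
        then show False using C y unfolding k_def by (auto simp: edge_iff[OF assms(1) xy])
      qed
      then have "x \<in> wing (blk x y)" "y \<in> cen (blk x y)" using C by (auto simp: edge_iff[OF C(1) xy])
      then show ?thesis using C cen_sub_core yX by blast
    qed
    obtain y z where yz: "k = {y, z}" "y \<noteq> z" using cardk by (auto simp: card_2_iff)
    obtain W where "{B \<in> D. x \<in> wing B \<and> cen B \<inter> core = {}} = {W}"
      using nwing_outer[OF xX] by (auto simp: card_1_singleton_iff)
    then have W: "blk x y = W" "blk x z = W" using *[of y] *[of z] yz by blast+
    then have "cen W = {y, z}" using *[of y] *[of z] yz block_parts(1)[of W] by (intro pair_set_eqI) auto
    then show ?thesis using *[of y] W yz by auto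
  qed
  obtain u v where uv: "cen B = {u, v}" "u \<noteq> v" using p(1) by (auto simp: card_2_iff)
  obtain C where C: "C \<in> D" "cen C = k" "u \<in> wing C" using key uv by auto
  obtain C' where C': "C' \<in> D" "cen C' = k" "v \<in> wing C'" using key uv by auto
  \<comment> \<open>The blocks found for the two ends of \<open>cen B\<close> share the central edge
    \<open>k\<close>, hence coincide by \<open>cen_outer\<close>, and the missing edge of that block
    is \<open>cen B\<close>.\<close>
  obtain y where "y \<in> k" using cardk by fastforce
  then have "C = C'" using cen_outer[OF C(1) C'(1), of y] C C' unfolding k_def by auto
  then have "wing C = cen B" using C C' uv block_parts(2) by (metis pair_set_eqI)
  then show ?thesis using block_eq[OF C(1)] C unfolding k_def by metis
qed

theorem design_structure:
  assumes A: "core = {a, b, c, d}" "distinct [a, b, c, d]" and x: "x \<in> X - core"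
  shows "\<exists>P Q R M N K. card P = 2 \<and> card Q = 2 \<and> card R = 2 \<and> card M = 2 \<and> card N = 2 \<and> card K = 2
    \<and> P \<union> Q \<union> R = X - core \<and> M \<union> N \<union> K = X - core \<and> x \<in> M
    \<and> D = {kgraph {a,b} P, kgraph {c,d} P, kgraph {a,c} Q, kgraph {b,d} Q, kgraph {a,d} R, kgraph {b,c} R,
           kgraph M N, kgraph N K, kgraph K M}"
proof -
  define P Q R where "P = pw a b" and "Q = pw a c" and "R = pw a d"
  have opp: "pw c d = P" "pw b d = Q" "pw b c = R"
    using pw_opposite[of a b c d] pw_opposite[of a c b d] pw_opposite[of a d b c] A
    unfolding P_def Q_def R_def by (auto simp: insert_commute)
  \<comment> \<open>A block in which \<open>x\<close> is central becomes the first outer block; this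
    gives \<open>x \<in> M\<close>.\<close>
  have "{B \<in> D. x \<in> cen B} \<noteq> {}"
    using ncen_cases[of x] x unfolding ncen_def by (metis DiffD1 card.empty zero_neq_numeral zero_neq_one)
  then obtain B where B: "B \<in> D" "x \<in> cen B" by auto
  define M N K where "M = cen B" and "N = wing B" and "K = X - core - M - N"
  have Bc: "M \<inter> core = {}" using cen_sub_core[of _ B] B x unfolding M_def by blast
  have eq1: "B = kgraph M N" using block_eq[OF B(1)] unfolding M_def N_def .
  have cMN: "card M = 2" "card N = 2" "M \<inter> N = {}" "card K = 2"
    using block_parts(1-3)[OF B(1)] outer_third[OF B(1)] Bc unfolding K_def M_def N_def by auto
  have sub: "M \<subseteq> X - core" "N \<subseteq> X - core"
    using cen_sub[OF B(1)] wing_sub[OF B(1)] wing_core[OF B(1)] Bc unfolding M_def N_def by auto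
  have parts_eq: "cen (kgraph e p) = e \<and> wing (kgraph e p) = p"
    if g: "kgraph e p \<in> D" "card e = 2" "card p = 2" "e \<inter> p = {}" for e p
  proof -
    note q = block_parts(1-3)[OF g(1)]
    have *: "{x, y} \<in> kgraph e p \<longleftrightarrow> x \<in> cen (kgraph e p) \<and> y \<in> cen (kgraph e p) \<or>
       x \<in> cen (kgraph e p) \<and> y \<in> wing (kgraph e p) \<or> x \<in> wing (kgraph e p) \<and> y \<in> cen (kgraph e p)" if "x \<noteq> y" for x y
      using edge_iff[OF g(1) that] .
    obtain u v where uv: "e = {u, v}" "u \<noteq> v" using g by (auto simp: card_2_iff)
    obtain w z where wz: "p = {w, z}" "w \<noteq> z" using g by (auto simp: card_2_iff)
    have U: "cen (kgraph e p) \<union> wing (kgraph e p) = e \<union> p"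
      using Union_kgraph[of e p] Union_kgraph[OF q(1), of "wing (kgraph e p)"] block_eq[OF g(1)] g by simp
    \<comment> \<open>A central vertex is adjacent to all other vertices of its block, so the ends
      of the missing edge cannot be central.\<close>
    have "\<not> {w, z} \<in> kgraph e p" using edge_in_kgraph_iff[OF g(2-4) wz(2)] wz g(4) by auto
    then have "w \<notin> cen (kgraph e p) \<and> z \<notin> cen (kgraph e p)" using *[OF wz(2)] U wz by auto
    then have "w \<in> wing (kgraph e p)" "z \<in> wing (kgraph e p)" using U wz by auto
    then have "wing (kgraph e p) = p" using q(2) wz by (metis pair_set_eqI)
    then show ?thesis using U q(3) g(4) by blast
  qed
  \<comment> \<open>Applying \<open>outer_step\<close> to \<open>B\<close> yields
    \<open>kgraph K M\<close>, and applying it to that block yields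
    \<open>kgraph N K\<close>.\<close>
  have D2: "kgraph K M \<in> D" using outer_step[OF B(1)] Bc unfolding K_def M_def N_def by simp
  have KM: "cen (kgraph K M) = K" "wing (kgraph K M) = M"
    using parts_eq[OF D2] cMN unfolding K_def by auto
  have D3: "kgraph N K \<in> D"
  proof -
    have "X - core - K - M = N" using cMN sub unfolding K_def by auto
    then show ?thesis using outer_step[OF D2] KM unfolding K_def by auto
  qed
  have NK: "cen (kgraph N K) = N" using parts_eq[OF D3] cMN unfolding K_def by auto
  have U: "M \<union> N \<union> K = X - core" using sub unfolding K_def by auto
  have E: "kgraph {a,b} P \<in> D" "kgraph {c,d} P \<in> D" "kgraph {a,c} Q \<in> D" "kgraph {b,d} Q \<in> D"
     "kgraph {a,d} R \<in> D" "kgraph {b,c} R \<in> D"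
     "blk a b = kgraph {a,b} P" "blk c d = kgraph {c,d} P" "blk a c = kgraph {a,c} Q"
     "blk b d = kgraph {b,d} Q" "blk a d = kgraph {a,d} R" "blk b c = kgraph {b,c} R"
    using pw_props(3,4)[of a b] pw_props(3,4)[of c d] pw_props(3,4)[of a c] pw_props(3,4)[of b d]
      pw_props(3,4)[of a d] pw_props(3,4)[of b c] A opp unfolding P_def Q_def R_def by auto
  have "C \<in> {kgraph {a,b} P, kgraph {c,d} P, kgraph {a,c} Q, kgraph {b,d} Q, kgraph {a,d} R, kgraph {b,c} R,
           kgraph M N, kgraph N K, kgraph K M}" if C: "C \<in> D" for C
  proof (cases "cen C \<inter> core = {}")
    case True
    obtain z where z: "z \<in> cen C" using block_parts(1)[OF C] by fastforce
    then have zX: "z \<in> X - core" using True cen_sub[OF C] by auto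
    then consider "z \<in> M" | "z \<in> N" | "z \<in> K" using U by auto
    then have "C = kgraph M N \<or> C = kgraph N K \<or> C = kgraph K M"
      using cen_outer[OF C B(1) zX z] cen_outer[OF C D2 zX z] cen_outer[OF C D3 zX z] KM NK eq1
      unfolding M_def by cases auto
    then show ?thesis by auto
  next
    case False
    then obtain u where u: "u \<in> core" "u \<in> cen C" by auto
    obtain v where v: "v \<in> core" "v \<noteq> u" "C = blk u v" using cen_core[OF u(1) C u(2)] by auto
    have "u \<in> {a, b, c, d}" "v \<in> {a, b, c, d}" using u(1) v(1) A(1) by auto
    then have "C \<in> {blk a b, blk c d, blk a c, blk b d, blk a d, blk b c}"
      using v(2,3) blk_commute[of b a] blk_commute[of d c] blk_commute[of c a] blk_commute[of d b]
        blk_commute[of d a] blk_commute[of c b] by (elim insertE emptyE) simp_all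
    then show ?thesis unfolding E(7-12) by blast
  qed
  then have "D = {kgraph {a,b} P, kgraph {c,d} P, kgraph {a,c} Q, kgraph {b,d} Q, kgraph {a,d} R, kgraph {b,c} R,
           kgraph M N, kgraph N K, kgraph K M}"
    using E(1-6) B(1) D2 D3 unfolding eq1 by (intro equalityI subsetI) (simp, blast)
  moreover have "card P = 2" "card Q = 2" "card R = 2" "P \<union> Q \<union> R = X - core"
    using pw_props(2)[of a b] pw_props(2)[of a c] pw_props(2)[of a d] pw_Un[OF A] A
    unfolding P_def Q_def R_def by auto
  ultimately show ?thesis
    using cMN U B(2) unfolding M_def[symmetric] by (intro exI conjI)
qed

end

section \<open>The three isomorphism types\<close>

definition inner_blocks :: "'a \<Rightarrow> 'a \<Rightarrow> 'a \<Rightarrow> 'a \<Rightarrow> 'a set \<Rightarrow> 'a set \<Rightarrow> 'a set \<Rightarrow> 'a set set set" where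
  "inner_blocks a b c d P Q R =
     {kgraph {a,b} P, kgraph {c,d} P, kgraph {a,c} Q, kgraph {b,d} Q, kgraph {a,d} R, kgraph {b,c} R}"

definition outer_blocks :: "'a set \<Rightarrow> 'a set \<Rightarrow> 'a set \<Rightarrow> 'a set set set" where
  "outer_blocks M N K = {kgraph M N, kgraph N K, kgraph K M}"

text \<open>The labels of the core and both partitions are parameters, so that changes of labelling
  become permutations of arguments.\<close>

definition presents ::
  "'a set \<Rightarrow> 'a set set set \<Rightarrow> 'a \<Rightarrow> 'a \<Rightarrow> 'a \<Rightarrow> 'a \<Rightarrow> 'a set \<Rightarrow> 'a set \<Rightarrow> 'a set \<Rightarrow> 'a set \<Rightarrow> 'a set \<Rightarrow> 'a set \<Rightarrow> bool" where
  "presents X D a b c d P Q R M N K \<longleftrightarrow>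
     distinct [a, b, c, d] \<and> X = {a, b, c, d} \<union> (P \<union> Q \<union> R) \<and> {a, b, c, d} \<inter> (P \<union> Q \<union> R) = {} \<and>
     card P = 2 \<and> card Q = 2 \<and> card R = 2 \<and> P \<inter> Q = {} \<and> P \<inter> R = {} \<and> Q \<inter> R = {} \<and>
     card M = 2 \<and> card N = 2 \<and> card K = 2 \<and> M \<inter> N = {} \<and> M \<inter> K = {} \<and> N \<inter> K = {} \<and>
     M \<union> N \<union> K = P \<union> Q \<union> R \<and>
     D = inner_blocks a b c d P Q R \<union> outer_blocks M N K"

text \<open>Exchanging two core vertices permutes the three perfect matchings of the core and with
  them the pairs they carry: here \<open>ad|bc\<close> is fixed, in \<open>presents_swap34\<close>
  it is \<open>ab|cd\<close>.\<close>

lemma presents_swap23: "presents X D a b c d P Q R M N K \<Longrightarrow> presents X D a c b d Q P R M N K"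
  unfolding presents_def inner_blocks_def by (auto simp: insert_commute Un_ac)

lemma presents_swap34: "presents X D a b c d P Q R M N K \<Longrightarrow> presents X D a b d c P R Q M N K"
  unfolding presents_def inner_blocks_def by (auto simp: insert_commute Un_ac)

text \<open>The outer blocks form a directed cycle: \<open>kgraph M N\<close> and
  \<open>kgraph N M\<close> have different central edges, so \<open>M\<close>, \<open>N\<close>,
  \<open>K\<close> may be rotated but not reversed.\<close>

lemma presents_rotate: "presents X D a b c d P Q R M N K \<Longrightarrow> presents X D a b c d P Q R N K M"
  unfolding presents_def outer_blocks_def by (auto simp: Un_ac)

lemma pairs_disjoint:
  assumes "card P = 2" "card Q = 2" "card R = 2" "card (P \<union> Q \<union> R) = 6"
  shows "P \<inter> Q = {} \<and> P \<inter> R = {} \<and> Q \<inter> R = {}"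
proof -
  have fin: "finite P" "finite Q" "finite R" using assms by (auto intro: card_ge_0_finite)
  have 1: "card (P \<union> Q) + card (P \<inter> Q) = 4" using card_Un_Int[OF fin(1,2)] assms by simp
  have 2: "card (P \<union> Q \<union> R) + card ((P \<union> Q) \<inter> R) = card (P \<union> Q) + 2"
    using card_Un_Int[of "P \<union> Q" R] fin assms by simp
  have "card (P \<inter> Q) = 0" "card ((P \<union> Q) \<inter> R) = 0" using 1 2 assms by linarith+
  then show ?thesis using fin by auto
qed

lemma (in design10) presents_ex:
  assumes "core = {a, b, c, d}" "distinct [a, b, c, d]" "x \<in> X - core"
  shows "\<exists>P Q R M N K. presents X D a b c d P Q R M N K \<and> x \<in> M"
proof -
  obtain P Q R M N K where *: "card P = 2" "card Q = 2" "card R = 2" "card M = 2" "card N = 2" "card K = 2"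
      "P \<union> Q \<union> R = X - core" "M \<union> N \<union> K = X - core" "x \<in> M"
      and D: "D = {kgraph {a,b} P, kgraph {c,d} P, kgraph {a,c} Q, kgraph {b,d} Q, kgraph {a,d} R, kgraph {b,c} R,
           kgraph M N, kgraph N K, kgraph K M}"
    using design_structure[OF assms] by (elim exE conjE) (rule that)
  have "D = inner_blocks a b c d P Q R \<union> outer_blocks M N K"
    unfolding D inner_blocks_def outer_blocks_def by (simp only: Un_insert_left Un_empty_left)
  moreover have "X = {a, b, c, d} \<union> (P \<union> Q \<union> R)" "{a, b, c, d} \<inter> (P \<union> Q \<union> R) = {}"
    using *(7) assms(1) core_sub by blast+
  ultimately have "presents X D a b c d P Q R M N K"
    using assms(2) pairs_disjoint[of P Q R] pairs_disjoint[of M N K] card_outer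
    using * unfolding presents_def by simp
  then show ?thesis using *(9) by blast
qed

text \<open>The listed triples correspond to three, one and no common pairs of the two partitions;
  two common pairs would force the third.\<close>

definition normal_form :: "'a set \<Rightarrow> 'a set set set \<Rightarrow> bool" where
  "normal_form X D \<longleftrightarrow> (\<exists>a b c d p p' q q' r r'.
     distinct [a, b, c, d, p, p', q, q', r, r'] \<and> X = {a, b, c, d, p, p', q, q', r, r'} \<and>
     (\<exists>(M, N, K) \<in> {({p,p'}, {q,q'}, {r,r'}), ({p,p'}, {q,r}, {q',r'}), ({p,q}, {p',r}, {q',r'})}.
       D = inner_blocks a b c d {p,p'} {q,q'} {r,r'} \<union> outer_blocks M N K))"

lemma normal_formI:
  assumes S: "presents X D a b c d P Q R M N K" and "P = {p, p'}" "Q = {q, q'}" "R = {r, r'}"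
    "(M, N, K) \<in> {({p,p'}, {q,q'}, {r,r'}), ({p,p'}, {q,r}, {q',r'}), ({p,q}, {p',r}, {q',r'})}"
  shows "normal_form X D"
proof -
  have "p \<noteq> p'" "q \<noteq> q'" "r \<noteq> r'" using S assms(2-4) unfolding presents_def by (auto simp: card_2_iff)
  moreover have "distinct [a, b, c, d]" "X = {a, b, c, d} \<union> ({p,p'} \<union> {q,q'} \<union> {r,r'})"
    "{a, b, c, d} \<inter> ({p,p'} \<union> {q,q'} \<union> {r,r'}) = {}"
    "{p,p'} \<inter> {q,q'} = {}" "{p,p'} \<inter> {r,r'} = {}" "{q,q'} \<inter> {r,r'} = {}"
    using S[unfolded presents_def assms(2-4)] by simp_all
  ultimately have "distinct [a, b, c, d, p, p', q, q', r, r']" "X = {a, b, c, d, p, p', q, q', r, r'}"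
    by (simp add: eq_commute, simp only: Un_insert_left Un_insert_right Un_empty_left Un_empty_right insert_commute)
  moreover have "D = inner_blocks a b c d {p,p'} {q,q'} {r,r'} \<union> outer_blocks M N K"
    using S unfolding presents_def assms(2-4) by blast
  ultimately show ?thesis
    unfolding normal_form_def using assms(5) by blast
qed

text \<open>\<open>Q\<close> is contained in neither \<open>N\<close> nor \<open>K\<close>, so it
  has one point in each; the partners of these points in \<open>N\<close> and \<open>K\<close> make
  up \<open>R\<close>.\<close>

lemma two_pairs:
  assumes "card Q = 2" "card R = 2" "Q \<inter> R = {}" "card N = 2" "card K = 2" "N \<inter> K = {}" "Q \<union> R = N \<union> K"
    "Q \<noteq> N" "Q \<noteq> K"
  shows "\<exists>q q' r r'. Q = {q, q'} \<and> R = {r, r'} \<and> N = {q, r} \<and> K = {q', r'}"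
proof -
  obtain x y where Q: "Q = {x, y}" "x \<noteq> y" using assms by (auto simp: card_2_iff)
  obtain z w where R: "R = {z, w}" "z \<noteq> w" using assms by (auto simp: card_2_iff)
  obtain i j where N: "N = {i, j}" "i \<noteq> j" using assms by (auto simp: card_2_iff)
  obtain k l where K: "K = {k, l}" "k \<noteq> l" using assms by (auto simp: card_2_iff)
  have "\<not> Q \<subseteq> N" "\<not> Q \<subseteq> K" using assms(8,9) Q N K by (auto simp: doubleton_eq_iff)
  then have "x \<in> N \<and> y \<in> K \<or> y \<in> N \<and> x \<in> K" using assms(7) Q by blast
  then obtain q q' where q: "Q = {q, q'}" "q \<in> N" "q' \<in> K" using Q(1) by blast
  have "card (N - {q}) = 1" "card (K - {q'}) = 1" using assms(4,5) q by auto
  then obtain r r' where r: "N - {q} = {r}" "K - {q'} = {r'}" by (auto simp: card_1_singleton_iff)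
  then have NK: "N = {q, r}" "K = {q', r'}" using q by auto
  moreover have "r \<in> Q \<union> R" "r' \<in> Q \<union> R" using r assms(7) by auto
  moreover have "r \<noteq> q" "r \<noteq> q'" "r' \<noteq> q" "r' \<noteq> q'" "r \<noteq> r'" using r q assms(6) by auto
  ultimately have "r \<in> R" "r' \<in> R" "r \<noteq> r'" using q(1) by auto
  then have "R = {r, r'}" using assms(2) pair_set_eqI by metis
  then show ?thesis using q NK by blast
qed

lemma normal_form_shared:
  assumes S: "presents X D a b c d P Q R P N K"
  shows "normal_form X D"
proof -
  obtain p p' where P: "P = {p, p'}" using S unfolding presents_def by (auto simp: card_2_iff)
  obtain q q' r r' where qq: "Q = {q, q'}" and rr: "R = {r, r'}"
    using S unfolding presents_def by (auto simp: card_2_iff)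
  have eq: "Q \<union> R = N \<union> K" using S unfolding presents_def by blast
  consider "Q = N" | "Q = K" | "Q \<noteq> N" "Q \<noteq> K" by auto
  then show ?thesis
  proof cases
    case 1
    then have "R = K" using eq S unfolding presents_def by blast
    then show ?thesis using normal_formI[OF S P qq rr] 1 P qq rr by simp
  next
    \<comment> \<open>Here the cycle runs in the other direction, which exchanging \<open>Q\<close>
      and \<open>R\<close> repairs.\<close>
    case 2
    then have "R = N" using eq S unfolding presents_def by blast
    then show ?thesis using normal_formI[OF presents_swap34[OF S] P rr qq] 2 P qq rr by simp
  next
    case 3
    then obtain q q' r r' where "Q = {q, q'}" "R = {r, r'}" "N = {q, r}" "K = {q', r'}"
      using two_pairs[of Q R N K] eq S unfolding presents_def by auto
    then show ?thesis using normal_formI[OF S P] P by auto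
  qed
qed

text \<open>The pairs of the two partitions alternate along the hexagon \<open>u u' v' w' w v\<close>.\<close>

lemma normal_form_hexagon:
  assumes S: "presents X D a b c d P Q R M N K" and u: "u \<in> M" "u \<in> P" "u' \<in> M" "u' \<in> Q"
    and v: "v \<in> P" "v \<in> N" and ne: "R \<noteq> K"
  shows "normal_form X D"
proof -
  have "u \<noteq> u'" "u \<noteq> v" using u v S unfolding presents_def by auto
  then have M: "M = {u, u'}" and P: "P = {u, v}"
    using u v S pair_set_eqI unfolding presents_def by metis+
  have "card (Q - {u'}) = 1" "card (N - {v}) = 1" using S u v unfolding presents_def by auto
  then obtain v' w where "Q - {u'} = {v'}" "N - {v} = {w}" by (auto simp: card_1_singleton_iff)
  then have Q: "Q = {u', v'}" "u' \<noteq> v'" and N: "N = {v, w}" "v \<noteq> w" using u v by auto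
  have d: "Q \<inter> R = {}" "P \<inter> R = {}" "P \<inter> Q = {}" "M \<inter> N = {}" "M \<inter> K = {}" "N \<inter> K = {}" "M \<union> N \<union> K = P \<union> Q \<union> R"
    "card R = 2" "card K = 2"
    using S unfolding presents_def by auto
  \<comment> \<open>If \<open>w = v'\<close>, the alternating cycle closes after four points, and
    the remaining pairs \<open>R\<close> and \<open>K\<close> agree.\<close>
  have "w \<noteq> v'"
  proof
    assume "w = v'"
    then have "R = K" using d M P Q N by auto
    then show False using ne by simp
  qed
  then have w: "w \<in> R" "v' \<in> K" using d(3-7) M N P Q \<open>u \<noteq> u'\<close> \<open>u \<noteq> v\<close> by auto
  have "card (R - {w}) = 1" using d w by auto
  then obtain w' where "R - {w} = {w'}" by (auto simp: card_1_singleton_iff)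
  then have R: "R = {w, w'}" "w \<noteq> w'" using w by auto
  have "w' \<in> M \<union> N \<union> K" using d(7) R by auto
  moreover have "w' \<notin> M" "w' \<notin> N" using d(1-3) R P Q M N by auto
  ultimately have "w' \<in> K" by blast
  moreover have "v' \<noteq> w'" using d(1) Q R by auto
  ultimately have "K = {v', w'}" using w d(9) by (intro pair_set_eqI) auto
  then show ?thesis
    using normal_formI[OF S P Q(1) R(1)] M N by simp
qed

text \<open>The hexagon must be followed in the direction of the cycle \<open>M\<close>,
  \<open>N\<close>, \<open>K\<close>. If neither the second point of \<open>P\<close> nor that of
  \<open>Q\<close> were in \<open>N\<close>, both would be in \<open>K\<close>, forcing
  \<open>R = N\<close>.\<close>

lemma normal_form_disjoint:
  assumes S: "presents X D a b c d P Q R M N K" and ne: "M \<noteq> P" "R \<noteq> N" "R \<noteq> K" "P \<noteq> M" "Q \<noteq> M"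
    and u: "u \<in> M" "u \<in> P" "u' \<in> M" "u' \<in> Q"
  shows "normal_form X D"
proof -
  have "u \<noteq> u'" using u S unfolding presents_def by auto
  then have M: "M = {u, u'}" using u S pair_set_eqI unfolding presents_def by metis
  have "card (P - {u}) = 1" "card (Q - {u'}) = 1" using u S unfolding presents_def by auto
  then obtain v v' where "P - {u} = {v}" "Q - {u'} = {v'}" by (auto simp: card_1_singleton_iff)
  then have P: "P = {u, v}" "u \<noteq> v" and Q: "Q = {u', v'}" "u' \<noteq> v'" using u by auto
  have d: "P \<inter> Q = {}" "M \<inter> N = {}" "M \<inter> K = {}" "N \<inter> K = {}" "M \<union> N \<union> K = P \<union> Q \<union> R" "Q \<inter> R = {}" "P \<inter> R = {}"
    "card K = 2" "card N = 2"
    using S unfolding presents_def by auto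
  have "v \<in> M \<union> N \<union> K" "v' \<in> M \<union> N \<union> K" using d(5) P Q by auto
  moreover have "v \<notin> M" "v' \<notin> M" using d(1) P Q M by auto
  ultimately consider "v \<in> N" | "v' \<in> N" | "v \<in> K" "v' \<in> K" by blast
  then show ?thesis
  proof cases
    case 1
    then show ?thesis using normal_form_hexagon[OF S u] P ne by auto
  next
    case 2
    then show ?thesis using normal_form_hexagon[OF presents_swap23[OF S] u(3,4,1,2)] Q ne by auto
  next
    case 3
    then have "K = {v, v'}" using d P Q by (intro pair_set_eqI) auto
    then have "R = N" using d M P Q by auto
    then show ?thesis using ne by simp
  qed
qed

theorem (in design10) design_normal_form: "normal_form X D"
proof -
  have "\<exists>a b c d. core = {a, b, c, d} \<and> distinct [a, b, c, d]"
  proof -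
    obtain xs where xs: "set xs = core" "distinct xs" using finite_distinct_list[OF finite_core] by blast
    then have "length xs = 4" using card_core distinct_card by metis
    then obtain a b c d where abcd: "xs = [a, b, c, d]" by (auto simp: length_Suc_conv numeral_eq_Suc)
    then show ?thesis using xs by (intro exI[of _ a] exI[of _ b] exI[of _ c] exI[of _ d]) (simp only: abcd list.set)
  qed
  then obtain a b c d where A: "core = {a, b, c, d}" "distinct [a, b, c, d]" by blast
  obtain x where "x \<in> X - core" using card_outer by (metis all_not_in_conv card.empty zero_neq_numeral)
  then obtain P Q R M N K where S: "presents X D a b c d P Q R M N K" using presents_ex[OF A] by blast
  show ?thesis
  proof (cases "{P, Q, R} \<inter> {M, N, K} = {}")
    case False
    \<comment> \<open>A common pair is renamed \<open>P\<close> by permuting the core, and then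
      rotated into the place of \<open>M\<close>.\<close>
    then have "\<exists>a b c d P Q R. presents X D a b c d P Q R M N K \<and> P \<in> {M, N, K}"
      using S presents_swap23[OF S] presents_swap23[OF presents_swap34[OF S]] by blast
    then show ?thesis
      using presents_rotate normal_form_shared by (metis insertE emptyE)
  next
    case True
    obtain u u' where u: "M = {u, u'}" "u \<noteq> u'" using S unfolding presents_def by (auto simp: card_2_iff)
    \<comment> \<open>No pair of the first partition equals \<open>M\<close>, so the two points of
      \<open>M\<close> lie in different pairs; permuting the core reduces the six possibilities to
      one.\<close>
    have ne: "\<not> (u \<in> F \<and> u' \<in> F)" if "F \<in> {P, Q, R}" for F
    proof
      assume "u \<in> F \<and> u' \<in> F"
      moreover have "card F = 2" using that S unfolding presents_def by auto
      ultimately have "F = M" using u pair_set_eqI by metis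
      then show False using that True by auto
    qed
    have "u \<in> P \<union> Q \<union> R" "u' \<in> P \<union> Q \<union> R" using S u(1) unfolding presents_def by blast+
    then consider "u \<in> P" "u' \<in> Q" | "u \<in> Q" "u' \<in> P" | "u \<in> P" "u' \<in> R" | "u \<in> R" "u' \<in> P"
      | "u \<in> Q" "u' \<in> R" | "u \<in> R" "u' \<in> Q" using ne by blast
    then have "\<exists>a b c d P Q R u u'. presents X D a b c d P Q R M N K \<and> {P, Q, R} \<inter> {M, N, K} = {} \<and>
        u \<in> M \<and> u \<in> P \<and> u' \<in> M \<and> u' \<in> Q"
    proof cases
      case 1 then show ?thesis using S u True by blast
    next
      case 2 then show ?thesis using presents_swap23[OF S] u True by blast
    next
      case 3 then show ?thesis using presents_swap34[OF S] u True by blast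
    next
      case 4 then show ?thesis using presents_swap23[OF presents_swap34[OF S]] u True by blast
    next
      case 5 then show ?thesis using presents_swap34[OF presents_swap23[OF S]] u True by blast
    next
      case 6 then show ?thesis using presents_swap23[OF presents_swap34[OF presents_swap23[OF S]]] u True by blast
    qed
    then show ?thesis using normal_form_disjoint by (smt (verit) disjoint_insert(1) insert_iff disjoint_iff)
  qed
qed

section \<open>Common blocks and common triangles\<close>

lemma tri_kgraph:
  assumes "card e = 2" "card p = 2" "e \<inter> p = {}"
  shows "tri (kgraph e p) = (\<lambda>x. insert x e) ` p"
proof -
  obtain a b where e: "e = {a, b}" "a \<noteq> b" using assms by (auto simp: card_2_iff)
  obtain c d where p: "p = {c, d}" "c \<noteq> d" using assms by (auto simp: card_2_iff)
  have ne: "a \<noteq> c" "a \<noteq> d" "b \<noteq> c" "b \<noteq> d" using assms(3) e p by auto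
  have "t = {a, b, c} \<or> t = {a, b, d}" if t: "t \<in> tri (kgraph e p)" for t
  proof -
    have c3: "card t = 3" and E: "\<And>x y. x \<in> t \<Longrightarrow> y \<in> t \<Longrightarrow> x \<noteq> y \<Longrightarrow> {x, y} \<in> kgraph e p"
      using t unfolding tri_def by auto
    have sub: "t \<subseteq> {a, b, c, d}"
    proof
      fix x assume x: "x \<in> t"
      have "t - {x} \<noteq> {}" using c3 x by (metis card.empty card_Suc_Diff1 card.infinite finite.emptyI numeral_3_eq_3 nat.inject zero_neq_numeral nat.distinct(1))
      then obtain y where "y \<in> t" "y \<noteq> x" by auto
      then have "{x, y} \<in> kgraph e p" using E x by auto
      then show "x \<in> {a, b, c, d}" using Union_kgraph[OF assms(1), of p] e p by auto
    qed
    \<comment> \<open>A triangle through both \<open>c\<close> and \<open>d\<close> would require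
      the missing edge.\<close>
    have "\<not> (c \<in> t \<and> d \<in> t)"
      using E[of c d] edge_in_kgraph_iff[OF assms p(2)] p ne e by auto
    then have "t \<subseteq> {a, b, c} \<or> t \<subseteq> {a, b, d}" using sub by auto
    moreover have "card {a, b, c} = 3" "card {a, b, d} = 3" using e ne by auto
    ultimately show ?thesis using c3 card_subset_eq by (metis finite.emptyI finite.insertI)
  qed
  moreover have "{a, b, c} \<in> tri (kgraph e p)" "{a, b, d} \<in> tri (kgraph e p)"
    using e(2) p(2) ne unfolding tri_def e(1) p(1) kblock_eq_kgraph[symmetric] kblock_def
    by (simp_all add: insert_commute)
  ultimately have "tri (kgraph e p) = {{a, b, c}, {a, b, d}}" by blast
  then show ?thesis using e p by (auto simp: insert_commute)
qed

lemma tri_card: "t \<in> tri B \<Longrightarrow> card t = 3" unfolding tri_def by auto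
lemma tri_edge: "t \<in> tri B \<Longrightarrow> x \<in> t \<Longrightarrow> y \<in> t \<Longrightarrow> x \<noteq> y \<Longrightarrow> {x, y} \<in> B" unfolding tri_def by auto

lemma tri_disjoint:
  assumes "k4e_design X D" "B \<in> D" "B' \<in> D" "B \<noteq> B'"
  shows "tri B \<inter> tri B' = {}"
proof (rule equals0I)
  fix t assume t: "t \<in> tri B \<inter> tri B'"
  then obtain x y where xy: "x \<in> t" "y \<in> t" "x \<noteq> y"
    using tri_card[of t B] by (auto simp: card_3_iff)
  then show False
    using t tri_edge[of t B x y] tri_edge[of t B' x y] design_edge_unique[OF assms(1-3), of x y] assms(4) by simp
qed

text \<open>Two triangles on the edge \<open>ab\<close> lie in the one block of \<open>D\<close>
  that covers \<open>ab\<close>, and they determine that block: its central edge is their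
  intersection.\<close>

lemma common_block_iff:
  assumes D: "k4e_design X D" and "a \<noteq> b" "c \<noteq> d" "{a, b} \<inter> {c, d} = {}"
  shows "kgraph {a, b} {c, d} \<in> D \<longleftrightarrow> {a, b, c} \<in> tris D \<and> {a, b, d} \<in> tris D"
proof
  let ?B = "kgraph {a, b} {c, d}"
  have tB: "tri ?B = {{a, b, c}, {a, b, d}}"
    using tri_kgraph[of "{a, b}" "{c, d}"] assms by (auto simp: insert_commute)
  { assume "?B \<in> D" then show "{a, b, c} \<in> tris D \<and> {a, b, d} \<in> tris D"
      using tB unfolding tris_def by blast }
  assume "{a, b, c} \<in> tris D \<and> {a, b, d} \<in> tris D"
  then obtain B C where B: "B \<in> D" "{a, b, c} \<in> tri B" and C: "C \<in> D" "{a, b, d} \<in> tri C"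
    unfolding tris_def by auto
  have "{a, b} \<in> B" "{a, b} \<in> C" using tri_edge[OF B(2), of a b] tri_edge[OF C(2), of a b] assms by auto
  then have "B = C" using design_edge_unique[OF D B(1) C(1)] assms by auto
  have "is_block B" using D B unfolding k4e_design_def by auto
  then obtain e p where ep: "card e = 2" "card p = 2" "e \<inter> p = {}" "B = kgraph e p"
    unfolding is_block_iff_kgraph by auto
  have "{{a, b, c}, {a, b, d}} \<subseteq> (\<lambda>x. insert x e) ` p"
    using B C \<open>B = C\<close> ep(4) tri_kgraph[OF ep(1-3)] by auto
  then obtain x y where xy: "x \<in> p" "y \<in> p" "{a, b, c} = insert x e" "{a, b, d} = insert y e" by auto
  have "x \<noteq> y" using xy(3,4) assms by auto
  then have "e = insert x e \<inter> insert y e" using xy(1,2) ep(3) by auto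
  also have "\<dots> = {a, b}" using xy(3,4)[symmetric] assms by auto
  finally have e: "e = {a, b}" .
  then have "x = c" "y = d" using xy ep(3) assms by auto
  then have "p = {c, d}" using xy(1,2) ep(2) \<open>x \<noteq> y\<close> pair_set_eqI by metis
  then show "?B \<in> D" using e ep(4) B(1) by simp
qed

lemma card_common_tris:
  assumes D: "k4e_design X D" and "finite X"
  shows "card (T \<inter> tris D) = (\<Sum>B\<in>D. card (T \<inter> tri B))"
proof -
  have fin: "finite (tri B)" if "B \<in> D" for B
  proof -
    have "is_block B" using D that unfolding k4e_design_def by auto
    then obtain e p where ep: "card e = 2" "card p = 2" "e \<inter> p = {}" "B = kgraph e p"
      unfolding is_block_iff_kgraph by auto
    then have "finite p" by (auto intro: card_ge_0_finite)
    then show ?thesis using tri_kgraph[OF ep(1-3)] ep(4) by auto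
  qed
  have "T \<inter> tris D = (\<Union>B\<in>D. T \<inter> tri B)" unfolding tris_def by auto
  also have "card \<dots> = (\<Sum>B\<in>D. card (T \<inter> tri B))"
    using fin tri_disjoint[OF D] finite_design[OF assms] by (intro card_UN_disjoint) blast+
  finally show ?thesis .
qed

section \<open>Blocks as tuples, and the counts of common blocks and triangles\<close>

type_synonym 'a blk = "('a \<times> 'a) \<times> ('a \<times> 'a)"

definition graph_of :: "'a blk \<Rightarrow> 'a set set" where
  "graph_of = (\<lambda>((a, b), (c, d)). kgraph {a, b} {c, d})"

definition proper :: "'a blk \<Rightarrow> bool" where
  "proper = (\<lambda>((a, b), (c, d)). distinct [a, b, c, d])"

definition relabel :: "('a \<Rightarrow> 'b) \<Rightarrow> 'a blk \<Rightarrow> 'b blk" where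
  "relabel h = map_prod (map_prod h h) (map_prod h h)"

fun tally :: "bool \<Rightarrow> bool \<Rightarrow> nat \<times> nat \<Rightarrow> nat \<times> nat" where
  "tally True True (s, t) = (Suc s, t)"
| "tally True False (s, t) = (s, Suc t)"
| "tally False True (s, t) = (s, Suc t)"
| "tally False False (s, t) = (s, t)"

definition tally_block :: "('a \<Rightarrow> 'a \<Rightarrow> 'a \<Rightarrow> bool) \<Rightarrow> 'a blk \<Rightarrow> nat \<times> nat \<Rightarrow> nat \<times> nat" where
  "tally_block \<tau> = (\<lambda>((a, b), (c, d)). tally (\<tau> a b c) (\<tau> a b d))"

definition profile :: "('a \<Rightarrow> 'a \<Rightarrow> 'a \<Rightarrow> bool) \<Rightarrow> 'a blk list \<Rightarrow> nat \<times> nat" where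
  "profile \<tau> Bs = foldr (tally_block \<tau>) Bs (0, 0)"

lemma tally_eq: "tally x y z = (fst z + of_bool (x \<and> y), snd z + of_bool (x \<noteq> y))"
  by (cases "(x, y, z)" rule: tally.cases) auto

text \<open>Stated for a list of distinct blocks that need not form a design, so that induction
  applies. A block with both triangles common counts in \<open>fst\<close>, one with a single common
  triangle in \<open>snd\<close>.\<close>

lemma profile_sums:
  assumes D: "k4e_design X D"
    and proper: "\<And>B. B \<in> set Bs \<Longrightarrow> proper B"
    and dist: "distinct (map (graph_of \<circ> relabel h) Bs)" and h: "inj h"
    and \<tau>: "\<And>a b c. distinct [a, b, c] \<Longrightarrow> \<tau> a b c \<longleftrightarrow> {h a, h b, h c} \<in> tris D"
  shows "fst (profile \<tau> Bs) = card (D \<inter> (graph_of \<circ> relabel h) ` set Bs) \<and>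
    snd (profile \<tau> Bs) + 2 * fst (profile \<tau> Bs) = (\<Sum>B\<in>(graph_of \<circ> relabel h) ` set Bs. card (tris D \<inter> tri B))"
  using proper dist
proof (induction Bs)
  case Nil
  then show ?case by (simp add: profile_def)
next
  case (Cons B Bs)
  obtain a b c d where B: "B = ((a, b), (c, d))" by (cases B) auto
  let ?G = "graph_of \<circ> relabel h"
  have dd: "distinct [a, b, c, d]" using Cons.prems(1)[of B] B by (simp add: proper_def)
  then have ne: "h a \<noteq> h b" "h c \<noteq> h d" "{h a, h b} \<inter> {h c, h d} = {}" using h by (auto dest: injD)
  have GB: "?G B = kgraph {h a, h b} {h c, h d}" by (simp add: B graph_of_def relabel_def)
  have t: "\<tau> a b c \<longleftrightarrow> {h a, h b, h c} \<in> tris D" "\<tau> a b d \<longleftrightarrow> {h a, h b, h d} \<in> tris D" using \<tau> dd by auto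
  have in_D: "?G B \<in> D \<longleftrightarrow> \<tau> a b c \<and> \<tau> a b d" using common_block_iff[OF D ne] GB t by simp
  have "tri (?G B) = {{h a, h b, h c}, {h a, h b, h d}}"
    using tri_kgraph[of "{h a, h b}" "{h c, h d}"] ne GB by (auto simp: insert_commute)
  moreover have "{h a, h b, h c} \<noteq> {h a, h b, h d}" using ne by auto
  ultimately have tr: "card (tris D \<inter> tri (?G B)) = of_bool (\<tau> a b c) + of_bool (\<tau> a b d)"
    using t by (simp add: Int_insert_right)
  have p: "profile \<tau> (B # Bs) = tally (\<tau> a b c) (\<tau> a b d) (profile \<tau> Bs)"
    by (simp add: profile_def tally_block_def B)
  have notin: "?G B \<notin> ?G ` set Bs" using Cons.prems(2) by simp
  have IH: "fst (profile \<tau> Bs) = card (D \<inter> ?G ` set Bs)"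
    "snd (profile \<tau> Bs) + 2 * fst (profile \<tau> Bs) = (\<Sum>B\<in>?G ` set Bs. card (tris D \<inter> tri B))"
    using Cons by auto
  have "card (D \<inter> ?G ` set (B # Bs)) = card (D \<inter> ?G ` set Bs) + of_bool (?G B \<in> D)"
    using notin by (simp add: Int_insert_right)
  moreover have "(\<Sum>B\<in>?G ` set (B # Bs). card (tris D \<inter> tri B)) =
      card (tris D \<inter> tri (?G B)) + (\<Sum>B\<in>?G ` set Bs. card (tris D \<inter> tri B))"
    using notin by simp
  ultimately show ?case
    unfolding p tally_eq using IH tr in_D by auto
qed

lemma profile_design:
  assumes D: "k4e_design X D" and D': "k4e_design X D'" and fin: "finite X"
    and Bs: "D' = (graph_of \<circ> relabel h) ` set Bs" "length Bs = card D'"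
    and proper: "\<And>B. B \<in> set Bs \<Longrightarrow> proper B" and h: "inj h"
    and \<tau>: "\<And>a b c. distinct [a, b, c] \<Longrightarrow> \<tau> a b c \<longleftrightarrow> {h a, h b, h c} \<in> tris D"
  shows "profile \<tau> Bs = (s, t) \<longleftrightarrow> card (D \<inter> D') = s \<and> card (tris D \<inter> tris D') = t + 2 * s"
proof -
  \<comment> \<open>There are as many list entries as blocks, so no block is listed twice.\<close>
  have "distinct (map (graph_of \<circ> relabel h) Bs)"
    using Bs by (intro card_distinct) simp
  from profile_sums[OF D proper this h \<tau>] card_common_tris[OF D' fin, of "tris D"]
  show ?thesis unfolding Bs(1)[symmetric] by (auto simp: prod_eq_iff)
qed

section \<open>Enumerating the second design\<close>

datatype pt = P0 | P1 | P2 | P3 | P4 | P5 | P6 | P7 | P8 | P9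

definition pts :: "pt list" where "pts = [P0, P1, P2, P3, P4, P5, P6, P7, P8, P9]"

lemma set_pts: "set pts = UNIV" and distinct_pts: "distinct pts"
proof -
  have "x \<in> set pts" for x by (cases x) (simp_all add: pts_def)
  then show "set pts = UNIV" by auto
qed (simp add: pts_def)

text \<open>The order suits the \<open>foldr\<close> in \<open>profile\<close>: the blocks on
  \<open>p\<close> come last and are tallied first, as in \<open>inner_profiles1\<close>, which
  shares their tally between all choices of \<open>q\<close> and \<open>r\<close>.\<close>

definition inner_list :: "'a \<Rightarrow> 'a \<Rightarrow> 'a \<Rightarrow> 'a \<Rightarrow> 'a \<times> 'a \<Rightarrow> 'a \<times> 'a \<Rightarrow> 'a \<times> 'a \<Rightarrow> 'a blk list" where
  "inner_list a b c d p q r = [((a,c),q), ((b,d),q), ((a,d),r), ((b,c),r), ((a,b),p), ((c,d),p)]"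

definition outer_list :: "'a \<times> 'a \<Rightarrow> 'a \<times> 'a \<Rightarrow> 'a \<times> 'a \<Rightarrow> 'a blk list" where
  "outer_list m n k = [(m,n), (n,k), (k,m)]"

fun blocks_of :: "'a list \<times> 'a list \<Rightarrow> 'a blk list" where
  "blocks_of ([a,b,c,d,p,p',q,q',r,r'], [m,m',n,n',k,k']) =
     inner_list a b c d (p,p') (q,q') (r,r') @ outer_list (m,m') (n,n') (k,k')"

text \<open>This and the next two are the cases of \<open>normal_form\<close>, with
  \<open>P0\<close> to \<open>P9\<close> for its ten labels in order.\<close>

definition form1 :: "pt blk list" where "form1 = blocks_of (pts, [P4,P5,P6,P7,P8,P9])"
definition form2 :: "pt blk list" where "form2 = blocks_of (pts, [P4,P5,P6,P8,P7,P9])"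
definition form3 :: "pt blk list" where "form3 = blocks_of (pts, [P4,P6,P5,P8,P7,P9])"

definition same_pair :: "'a \<Rightarrow> 'a \<Rightarrow> 'a \<Rightarrow> 'a \<Rightarrow> bool" where
  "same_pair x y a b = (if x = a then y = b else if x = b then y = a else False)"

text \<open>Organized by the edge \<open>xy\<close> rather than by the triangle, so that one list
  answers all queries on a line of the table.\<close>

definition thirds1 :: "'a \<Rightarrow> 'a \<Rightarrow> 'a blk \<Rightarrow> 'a list" where
  "thirds1 x y = (\<lambda>((a, b), (c, d)).
     if same_pair x y a b then [c, d]
     else if same_pair x y a c \<or> same_pair x y a d then [b]
     else if same_pair x y b c \<or> same_pair x y b d then [a] else [])"

primrec thirds :: "'a blk list \<Rightarrow> 'a \<Rightarrow> 'a \<Rightarrow> 'a list" where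
  "thirds [] x y = []"
| "thirds (B # Bs) x y = thirds1 x y B @ thirds Bs x y"

primrec mem :: "'a list \<Rightarrow> 'a \<Rightarrow> bool" where
  "mem [] x = False"
| "mem (y # ys) x = (if x = y then True else mem ys x)"

text \<open>\<open>memo f\<close> equals \<open>f\<close>; the simplifier evaluates the ten values once, after which each call is a
  single rewrite step. For the same reason the functions below are first-order.\<close>

definition memo :: "(pt \<Rightarrow> 'a) \<Rightarrow> pt \<Rightarrow> 'a" where
  "memo f = case_pt (f P0) (f P1) (f P2) (f P3) (f P4) (f P5) (f P6) (f P7) (f P8) (f P9)"

definition table_line :: "pt blk list \<Rightarrow> pt \<Rightarrow> pt \<Rightarrow> pt \<Rightarrow> bool" where
  "table_line Bs x y = memo (mem (thirds Bs x y))"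
definition table_plane :: "pt blk list \<Rightarrow> pt \<Rightarrow> pt \<Rightarrow> pt \<Rightarrow> bool" where
  "table_plane Bs x = memo (table_line Bs x)"
definition table :: "pt blk list \<Rightarrow> pt \<Rightarrow> pt \<Rightarrow> pt \<Rightarrow> bool" where
  "table Bs = memo (table_plane Bs)"

text \<open>Both parts keep the order of the list, so every subset of a duplicate-free list arises
  once: 210 cores, and for each of them 15 * 6 inner and 5 * 6 outer completions.\<close>

fun csplit :: "nat \<Rightarrow> 'a list \<Rightarrow> ('a list \<times> 'a list) list" where
  "csplit 0 xs = [([], xs)]"
| "csplit (Suc n) [] = []"
| "csplit (Suc n) (x # xs) = map (apfst ((#) x)) (csplit n xs) @ map (apsnd ((#) x)) (csplit (Suc n) xs)"

text \<open>Opposite core edges carry the same pair, so their two blocks are tallied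
  together.\<close>

fun tally2 :: "('a \<Rightarrow> bool) \<Rightarrow> ('a \<Rightarrow> bool) \<Rightarrow> 'a list \<Rightarrow> nat \<times> nat \<Rightarrow> nat \<times> nat" where
  "tally2 u v [x, y] z = tally (u x) (u y) (tally (v x) (v y) z)"

text \<open>\<open>List.insert\<close> keeps only different profiles, so that few sums remain to be
  checked for each core.\<close>

primrec inner_profiles2 where
  "inner_profiles2 u v u' v' z [] acc = acc"
| "inner_profiles2 u v u' v' z (w # ws) acc =
     inner_profiles2 u v u' v' z ws (List.insert (tally2 u v (fst w) (tally2 u' v' (snd w) z)) acc)"

primrec inner_profiles1 where
  "inner_profiles1 ab cd ac bd ad bc [] acc = acc"
| "inner_profiles1 ab cd ac bd ad bc (w # ws) acc =
     inner_profiles1 ab cd ac bd ad bc ws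
       (inner_profiles2 ac bd ad bc (tally2 ab cd (fst w) (0, 0)) (csplit 2 (snd w)) acc)"

definition inner_profiles ::
  "('a \<Rightarrow> 'a \<Rightarrow> 'a \<Rightarrow> bool) \<Rightarrow> 'a \<Rightarrow> 'a \<Rightarrow> 'a \<Rightarrow> 'a \<Rightarrow> 'a list \<Rightarrow> (nat \<times> nat) list" where
  "inner_profiles \<tau> a b c d bs =
     inner_profiles1 (\<tau> a b) (\<tau> c d) (\<tau> a c) (\<tau> b d) (\<tau> a d) (\<tau> b c) (csplit 2 bs) []"

fun row :: "('a \<Rightarrow> 'a \<Rightarrow> 'b) \<Rightarrow> 'a list \<Rightarrow> 'b" where "row \<tau> [x, y] = \<tau> x y"

fun tally1 :: "('a \<Rightarrow> bool) \<Rightarrow> 'a list \<Rightarrow> nat \<times> nat \<Rightarrow> nat \<times> nat" where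
  "tally1 u [x, y] z = tally (u x) (u y) z"

definition tally_cycle where
  "tally_cycle um un uk m n k = tally1 um n (tally1 un k (tally1 uk m (0, 0)))"

primrec outer_profiles2 where
  "outer_profiles2 \<tau> um m [] acc = acc"
| "outer_profiles2 \<tau> um m (w # ws) acc = outer_profiles2 \<tau> um m ws
     (List.insert (tally_cycle um (row \<tau> (fst w)) (row \<tau> (snd w)) m (fst w) (snd w)) acc)"

text \<open>Rotating the three outer blocks, we may assume that the first outer point \<open>x\<close> lies on the first
  central edge.\<close>

primrec outer_profiles1 where
  "outer_profiles1 \<tau> x [] acc = acc"
| "outer_profiles1 \<tau> x (w # ws) acc = outer_profiles1 \<tau> x ws
     (outer_profiles2 \<tau> (row \<tau> (x # fst w)) (x # fst w) (csplit 2 (snd w)) acc)"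

definition outer_profiles :: "('a \<Rightarrow> 'a \<Rightarrow> 'a \<Rightarrow> bool) \<Rightarrow> 'a list \<Rightarrow> (nat \<times> nat) list" where
  "outer_profiles \<tau> bs = outer_profiles1 \<tau> (hd bs) (csplit 1 (tl bs)) []"

primrec lookup :: "'a \<Rightarrow> 'a list \<Rightarrow> nat \<Rightarrow> 'a" where
  "lookup e [] n = e"
| "lookup e (x # xs) n = (case n of 0 \<Rightarrow> x | Suc m \<Rightarrow> lookup e xs m)"

text \<open>Row \<open>s\<close>, entry \<open>t\<close>; missing entries stand for \<open>False\<close>.\<close>

definition feasible_rows :: "bool list list" where
  "feasible_rows =
     [[True, True, True, True, True, True, True, True, True, True],
      [True, True, True, True, True, True, True, True],
      [True, True, True, True, True, True, True, True],
      [True, False, True, True, True, False, True],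
      [True, False, True, False, True],
      [True, False, False, False, True],
      [True, False, True, True],
      [], [], [True]]"

definition feasible :: "nat \<Rightarrow> nat \<Rightarrow> bool" where
  "feasible s t = lookup False (lookup [] feasible_rows s) t"

primrec sums_feasible1 where
  "sums_feasible1 z [] = True"
| "sums_feasible1 z (w # ws) = (if feasible (fst z + fst w) (snd z + snd w) then sums_feasible1 z ws else False)"

primrec sums_feasible where
  "sums_feasible [] ws = True"
| "sums_feasible (z # zs) ws = (if sums_feasible1 z ws then sums_feasible zs ws else False)"

fun check_core :: "(pt \<Rightarrow> pt \<Rightarrow> pt \<Rightarrow> bool) \<Rightarrow> pt list \<times> pt list \<Rightarrow> bool" where
  "check_core \<tau> ([a, b, c, d], bs) = sums_feasible (inner_profiles \<tau> a b c d bs) (outer_profiles \<tau> bs)"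

primrec check_cores where
  "check_cores \<tau> [] = True"
| "check_cores \<tau> (w # ws) = (if check_core \<tau> w then check_cores \<tau> ws else False)"

section \<open>Correctness of the enumeration\<close>

lemma mem_iff: "mem xs x \<longleftrightarrow> x \<in> set xs" by (induction xs) auto

lemma memo_eq: "memo f = f"
proof
  fix x show "memo f x = f x" unfolding memo_def by (cases x) simp_all
qed

lemma table_iff: "table Bs x y z \<longleftrightarrow> z \<in> set (thirds Bs x y)"
  unfolding table_def table_plane_def table_line_def memo_eq mem_iff ..

definition triples :: "'a blk list \<Rightarrow> 'a set set" where
  "triples Bs = (\<Union>((a, b), (c, d))\<in>set Bs. {{a, b, c}, {a, b, d}})"

lemma same_pair_iff: "x \<noteq> y \<Longrightarrow> same_pair x y a b \<longleftrightarrow> {x, y} = {a, b}"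
  unfolding same_pair_def by (auto simp: doubleton_eq_iff)

lemma triple_eq_iff:
  assumes "distinct [x, y, z]" "distinct [a, b, c]"
  shows "{x, y, z} = {a, b, c} \<longleftrightarrow> {x, y} = {a, b} \<and> z = c \<or> {x, y} = {a, c} \<and> z = b \<or> {x, y} = {b, c} \<and> z = a"
proof
  assume eq: "{x, y, z} = {a, b, c}"
  then have "{x, y} = {a, b, c} - {z}" "z \<in> {a, b, c}" using assms by auto
  then show "{x, y} = {a, b} \<and> z = c \<or> {x, y} = {a, c} \<and> z = b \<or> {x, y} = {b, c} \<and> z = a"
    using assms by auto
qed (auto simp: insert_commute)

lemma thirds1_iff:
  assumes "distinct [x, y, z]" "distinct [a, b, c, d]"
  shows "z \<in> set (thirds1 x y ((a, b), (c, d))) \<longleftrightarrow> {x, y, z} = {a, b, c} \<or> {x, y, z} = {a, b, d}"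
proof -
  have ne: "x \<noteq> y" using assms by simp
  have t: "{x, y, z} = {a, b, c} \<longleftrightarrow> {x, y} = {a, b} \<and> z = c \<or> {x, y} = {a, c} \<and> z = b \<or> {x, y} = {b, c} \<and> z = a"
    "{x, y, z} = {a, b, d} \<longleftrightarrow> {x, y} = {a, b} \<and> z = d \<or> {x, y} = {a, d} \<and> z = b \<or> {x, y} = {b, d} \<and> z = a"
    using triple_eq_iff[OF assms(1)] assms(2) by auto
  \<comment> \<open>The edges tested in different branches of \<open>thirds1\<close> differ, so the
    order of its conditionals is immaterial.\<close>
  have d: "{a, b} \<noteq> {a, c}" "{a, b} \<noteq> {a, d}" "{a, b} \<noteq> {b, c}" "{a, b} \<noteq> {b, d}"
    "{a, c} \<noteq> {b, c}" "{a, c} \<noteq> {b, d}" "{a, d} \<noteq> {b, c}" "{a, d} \<noteq> {b, d}"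
    using assms(2) by (auto simp: doubleton_eq_iff)
  show ?thesis
    unfolding thirds1_def t prod.case same_pair_iff[OF ne]
    by (cases "{x, y} = {a, b}"; cases "{x, y} = {a, c}"; cases "{x, y} = {a, d}";
        cases "{x, y} = {b, c}"; cases "{x, y} = {b, d}") (use d in simp_all)
qed

lemma thirds_iff:
  assumes "distinct [x, y, z]" "\<And>B. B \<in> set Bs \<Longrightarrow> proper B"
  shows "z \<in> set (thirds Bs x y) \<longleftrightarrow> {x, y, z} \<in> triples Bs"
  using assms(2)
proof (induction Bs)
  case (Cons B Bs)
  obtain a b c d where B: "B = ((a, b), (c, d))" by (cases B) auto
  then have "distinct [a, b, c, d]" using Cons.prems[of B] by (simp add: proper_def)
  then show ?case using Cons thirds1_iff[OF assms(1)] by (auto simp: B triples_def)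
qed (simp add: triples_def)

text \<open>An injective labelling induces an injective map on sets of points, so triangles can be
  tested before relabelling.\<close>

lemma tris_relabel:
  assumes h: "inj h" and proper: "\<And>B. B \<in> set Bs \<Longrightarrow> proper B"
  shows "{h x, h y, h z} \<in> tris ((graph_of \<circ> relabel h) ` set Bs) \<longleftrightarrow> {x, y, z} \<in> triples Bs"
proof -
  have "tri ((graph_of \<circ> relabel h) B) = (case B of ((a, b), (c, d)) \<Rightarrow> {h ` {a, b, c}, h ` {a, b, d}})"
    if "B \<in> set Bs" for B
  proof -
    obtain a b c d where B: "B = ((a, b), (c, d))" by (cases B) auto
    then have "distinct [a, b, c, d]" using proper[OF that] by (simp add: proper_def)
    then have ne: "h a \<noteq> h b" "h c \<noteq> h d" "{h a, h b} \<inter> {h c, h d} = {}" using h by (auto dest: injD)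
    then show ?thesis
      using tri_kgraph[of "{h a, h b}" "{h c, h d}"]
      by (auto simp: B graph_of_def relabel_def insert_commute)
  qed
  then have "tris ((graph_of \<circ> relabel h) ` set Bs) =
      (\<Union>B\<in>set Bs. case B of ((a, b), (c, d)) \<Rightarrow> {h ` {a, b, c}, h ` {a, b, d}})"
    unfolding tris_def by simp
  also have "\<dots> = (`) h ` triples Bs"
    unfolding triples_def image_UN by (rule SUP_cong) (auto split: prod.splits)
  finally have "tris ((graph_of \<circ> relabel h) ` set Bs) = (`) h ` triples Bs" .
  moreover have "{h x, h y, h z} = h ` {x, y, z}" by simp
  ultimately show ?thesis
    by (auto simp: image_iff inj_image_eq_iff[OF h] simp del: image_insert)
qed

text \<open>Supplies the hypothesis on \<open>\<tau>\<close> in \<open>profile_design\<close> for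
  the computed table.\<close>

lemma table_tris:
  assumes "inj h" "\<And>B. B \<in> set Bs \<Longrightarrow> proper B" "distinct [x, y, z]"
  shows "table Bs x y z \<longleftrightarrow> {h x, h y, h z} \<in> tris ((graph_of \<circ> relabel h) ` set Bs)"
  using table_iff thirds_iff[OF assms(3,2)] tris_relabel[OF assms(1,2)] by blast

lemma csplit_filter:
  "(filter P xs, filter (\<lambda>x. \<not> P x) xs) \<in> set (csplit (length (filter P xs)) xs)"
proof (induction xs)
  case (Cons x xs)
  show ?case
  proof (cases "P x")
    case True
    then show ?thesis using Cons by (force simp: apfst_def)
  next
    case False
    show ?thesis
    proof (cases "length (filter P xs)")
      \<comment> \<open>If no later entry satisfies \<open>P\<close>, the count is zero and
        \<open>csplit 0\<close> puts the whole list into the second part without recursion.\<close>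
      case 0
      then have "\<forall>y\<in>set xs. \<not> P y" by (simp add: filter_empty_conv)
      then show ?thesis using False by simp
    next
      case (Suc n)
      then show ?thesis using Cons False by (force simp: apsnd_def)
    qed
  qed
qed simp

text \<open>Pulls a set of labels taken from an arbitrary design back to one of the enumerated
  splits.\<close>

lemma csplit_image:
  assumes "inj h" "distinct xs" "P \<subseteq> h ` set xs"
  defines "ys \<equiv> filter (\<lambda>z. h z \<in> P) xs" and "zs \<equiv> filter (\<lambda>z. h z \<notin> P) xs"
  shows "(ys, zs) \<in> set (csplit (card P) xs)" "length ys = card P" "P = h ` set ys"
    "h ` set zs = h ` set xs - P" "distinct ys" "distinct zs" "set ys \<union> set zs = set xs" "set ys \<inter> set zs = {}"
proof -
  show P: "P = h ` set ys" "h ` set zs = h ` set xs - P" "distinct ys" "distinct zs"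
    "set ys \<union> set zs = set xs" "set ys \<inter> set zs = {}"
    using assms(2,3) unfolding ys_def zs_def by auto
  show "length ys = card P"
    using P(1) card_image[OF inj_on_subset[OF assms(1)], of "set ys"] distinct_card[OF P(3)] by simp
  then show "(ys, zs) \<in> set (csplit (card P) xs)"
    using csplit_filter[of "\<lambda>z. h z \<in> P" xs] unfolding ys_def zs_def by simp
qed

text \<open>This additivity is the reason why inner and outer profiles may be listed
  independently.\<close>

lemma profile_append:
  "profile \<tau> (Bs @ Cs) = (fst (profile \<tau> Bs) + fst (profile \<tau> Cs), snd (profile \<tau> Bs) + snd (profile \<tau> Cs))"
proof (induction Bs)
  case Nil
  then show ?case by (simp add: profile_def)
next
  case (Cons B Bs)
  then show ?case by (cases B) (auto simp: profile_def tally_block_def tally_eq)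
qed

text \<open>The accumulator only grows, so a profile entered at some stage is still present at the
  end; the other loops are treated alike.\<close>

lemma inner_profiles2_mono: "set acc \<subseteq> set (inner_profiles2 u v u' v' z ws acc)"
  by (induction ws arbitrary: acc) (simp, force)

lemma inner_profiles2_mem:
  "w \<in> set ws \<Longrightarrow> tally2 u v (fst w) (tally2 u' v' (snd w) z) \<in> set (inner_profiles2 u v u' v' z ws acc)"
proof (induction ws arbitrary: acc)
  case (Cons x ws)
  then show ?case
    using inner_profiles2_mono[of "List.insert (tally2 u v (fst x) (tally2 u' v' (snd x) z)) acc" u v u' v' z ws]
    by auto
qed simp

lemma inner_profiles1_mono: "set acc \<subseteq> set (inner_profiles1 ab cd ac bd ad bc ws acc)"
proof (induction ws arbitrary: acc)
  case (Cons w ws)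
  then show ?case using inner_profiles2_mono unfolding inner_profiles1.simps by fast
qed simp

lemma inner_profiles1_mem:
  assumes "w \<in> set ws" "w' \<in> set (csplit 2 (snd w))"
  shows "tally2 ac bd (fst w') (tally2 ad bc (snd w') (tally2 ab cd (fst w) (0, 0)))
    \<in> set (inner_profiles1 ab cd ac bd ad bc ws acc)"
  using assms(1)
proof (induction ws arbitrary: acc)
  case (Cons x ws)
  show ?case
  proof (cases "w = x")
    case True
    show ?thesis
      unfolding True[symmetric] inner_profiles1.simps
      using inner_profiles2_mem[OF assms(2)] inner_profiles1_mono by fast
  qed (use Cons in auto)
qed simp

lemma inner_profiles_mem:
  assumes "([p, p'], ws) \<in> set (csplit 2 bs)" "([q, q'], [r, r']) \<in> set (csplit 2 ws)"
  shows "profile \<tau> (inner_list a b c d (p, p') (q, q') (r, r')) \<in> set (inner_profiles \<tau> a b c d bs)"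
  using inner_profiles1_mem[OF assms(1), of "([q, q'], [r, r'])"] assms(2)
  by (simp add: inner_profiles_def inner_list_def profile_def tally_block_def)

lemma outer_profiles2_mono: "set acc \<subseteq> set (outer_profiles2 \<tau> um m ws acc)"
  by (induction ws arbitrary: acc) (simp, force)

lemma outer_profiles2_mem:
  "w \<in> set ws \<Longrightarrow> tally_cycle um (row \<tau> (fst w)) (row \<tau> (snd w)) m (fst w) (snd w) \<in> set (outer_profiles2 \<tau> um m ws acc)"
proof (induction ws arbitrary: acc)
  case (Cons x ws)
  then show ?case
    using outer_profiles2_mono[of "List.insert (tally_cycle um (row \<tau> (fst x)) (row \<tau> (snd x)) m (fst x) (snd x)) acc" \<tau> um m ws]
    by auto
qed simp

lemma outer_profiles1_mono: "set acc \<subseteq> set (outer_profiles1 \<tau> x ws acc)"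
proof (induction ws arbitrary: acc)
  case (Cons w ws)
  then show ?case using outer_profiles2_mono unfolding outer_profiles1.simps by fast
qed simp

lemma outer_profiles1_mem:
  assumes "w \<in> set ws" "w' \<in> set (csplit 2 (snd w))"
  shows "tally_cycle (row \<tau> (x # fst w)) (row \<tau> (fst w')) (row \<tau> (snd w')) (x # fst w) (fst w') (snd w')
    \<in> set (outer_profiles1 \<tau> x ws acc)"
  using assms(1)
proof (induction ws arbitrary: acc)
  case (Cons y ws)
  show ?case
  proof (cases "w = y")
    case True
    show ?thesis
      unfolding True[symmetric] outer_profiles1.simps
      using outer_profiles2_mem[OF assms(2)] outer_profiles1_mono by fast
  qed (use Cons in auto)
qed simp

lemma outer_profiles_mem:
  assumes "([m], ws) \<in> set (csplit 1 bs)" "([n, n'], [k, k']) \<in> set (csplit 2 ws)"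
  shows "profile \<tau> (outer_list (x, m) (n, n') (k, k')) \<in> set (outer_profiles \<tau> (x # bs))"
  using outer_profiles1_mem[OF assms(1), of "([n, n'], [k, k'])"] assms(2)
  by (simp add: outer_profiles_def outer_list_def profile_def tally_block_def tally_cycle_def)

lemma sums_feasible1_mem:
  "sums_feasible1 z ws \<Longrightarrow> w \<in> set ws \<Longrightarrow> feasible (fst z + fst w) (snd z + snd w)"
  by (induction ws) (auto split: if_splits)

lemma sums_feasible_mem:
  "sums_feasible zs ws \<Longrightarrow> z \<in> set zs \<Longrightarrow> w \<in> set ws \<Longrightarrow> feasible (fst z + fst w) (snd z + snd w)"
  by (induction zs) (auto split: if_splits intro: sums_feasible1_mem)

lemma check_cores_mem: "check_cores \<tau> ws \<Longrightarrow> w \<in> set ws \<Longrightarrow> check_core \<tau> w"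
  by (induction ws) (auto split: if_splits)

lemma length_2_ex: "length xs = 2 \<Longrightarrow> \<exists>x y. xs = [x, y]"
  by (auto simp: length_Suc_conv numeral_2_eq_2)

lemma length_4_ex: "length xs = 4 \<Longrightarrow> \<exists>a b c d. xs = [a, b, c, d]"
  by (auto simp: length_Suc_conv numeral_eq_Suc)

text \<open>\<open>D\<close> is a fixed form carried over by \<open>h\<close>, while
  \<open>D'\<close> is arbitrary; a presentation of \<open>D'\<close> is pulled back along
  \<open>h\<close> to one of the cases covered by \<open>check\<close>.\<close>

lemma feasible_profile:
  fixes h :: "pt \<Rightarrow> 'a"
  assumes h: "inj h" "range h = X" and D: "k4e_design X D" and form: "D = (graph_of \<circ> relabel h) ` set form"
    and proper: "\<And>B. B \<in> set form \<Longrightarrow> proper B"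
    and check: "check_cores (table form) (csplit 4 pts)" and D': "k4e_design X D'"
  shows "\<exists>s t. feasible s t \<and> card (D \<inter> D') = s \<and> card (tris D \<inter> tris D') = t + 2 * s"
proof -
  have X: "finite X" "card X = 10"
  proof -
    have "X = h ` set pts" using h(2) set_pts by simp
    then show "finite X" by simp
    have "card (h ` set pts) = card (set pts)" using h(1) by (intro card_image inj_on_subset[OF h(1)]) auto
    then show "card X = 10" using \<open>X = h ` set pts\<close> distinct_card[OF distinct_pts] by (simp add: pts_def)
  qed
  interpret E: design10 X D' by unfold_locales (use X D' in auto)
  have Xp: "X = h ` set pts" using h(2) set_pts by simp
  \<comment> \<open>The enumeration fixes the core of the second design first, hence
    \<open>E.core\<close> and not the core of \<open>D\<close>.\<close>
  define as bs where "as = filter (\<lambda>z. h z \<in> E.core) pts" and "bs = filter (\<lambda>z. h z \<notin> E.core) pts"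
  have "E.core \<subseteq> h ` set pts" using E.core_sub Xp by simp
  note ab = csplit_image[OF h(1) distinct_pts this, folded as_def bs_def]
  obtain a b c d where as: "as = [a, b, c, d]" using length_4_ex ab(2) E.card_core by metis
  have outer: "X - E.core = h ` set bs" using ab(4) Xp by simp
  then have "bs \<noteq> []" using E.card_outer by auto
  \<comment> \<open>The head of \<open>bs\<close> is the point that \<open>outer_profiles\<close>
    places on the first central edge; accordingly \<open>presents_ex\<close> is used below with
    \<open>h x \<in> M\<close>.\<close>
  then obtain x bs' where bs: "bs = x # bs'" by (cases bs) auto
  have Ecore: "E.core = {h a, h b, h c, h d}" "distinct [h a, h b, h c, h d]" "h x \<in> X - E.core"
    using ab(3,5) as outer bs inj_eq[OF h(1)] by simp_all
  then obtain P Q R M N K where S: "presents X D' (h a) (h b) (h c) (h d) P Q R M N K" and xM: "h x \<in> M"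
    using E.presents_ex by blast
  have PQR: "P \<union> Q \<union> R = h ` set bs" "M \<union> N \<union> K = h ` set bs"
  proof -
    have "U = V - W" if "V = W \<union> U" "W \<inter> U = {}" for U V W :: "'a set" using that by auto
    from this[of X "E.core" "P \<union> Q \<union> R"] have "P \<union> Q \<union> R = X - E.core"
      using S unfolding Ecore presents_def by argo
    then show "P \<union> Q \<union> R = h ` set bs" using outer by simp
    then show "M \<union> N \<union> K = h ` set bs" using S unfolding presents_def by argo
  qed
  have cd: "card P = 2" "card Q = 2" "card R = 2" "card M = 2" "card N = 2" "card K = 2"
     "P \<inter> Q = {}" "P \<inter> R = {}" "Q \<inter> R = {}" "M \<inter> N = {}" "M \<inter> K = {}" "N \<inter> K = {}"
    using S unfolding presents_def by auto
  \<comment> \<open>Splits the last four points into two pairs; applied to \<open>Q\<close>,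
    \<open>R\<close> and to \<open>N\<close>, \<open>K\<close>.\<close>
  have two: "\<exists>q q' r r'. ([q, q'], [r, r']) \<in> set (csplit 2 zs) \<and> Q' = {h q, h q'} \<and> R' = {h r, h r'} \<and>
      distinct [q, q', r, r'] \<and> {q, q', r, r'} \<subseteq> set zs"
    if z: "distinct zs" "h ` set zs = Q' \<union> R'" "card Q' = 2" "card R' = 2" "Q' \<inter> R' = {}" for zs Q' R'
  proof -
    define ys ws where "ys = filter (\<lambda>z. h z \<in> Q') zs" and "ws = filter (\<lambda>z. h z \<notin> Q') zs"
    have "Q' \<subseteq> h ` set zs" using z by auto
    note c = csplit_image[OF h(1) z(1) this, folded ys_def ws_def]
    have R': "R' = h ` set ws" using c(4) z(2,5) by auto
    then have "length ws = 2"
      using card_image[OF inj_on_subset[OF h(1)], of "set ws"] distinct_card[OF c(6)] z(4) by simp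
    then obtain r r' where ws: "ws = [r, r']" using length_2_ex by blast
    obtain q q' where ys: "ys = [q, q']" using length_2_ex c(2) z(3) by metis
    have "([q, q'], [r, r']) \<in> set (csplit 2 zs)" "Q' = {h q, h q'}" "R' = {h r, h r'}"
      using c(1,3) ws ys R' z(3) by simp_all
    moreover have "distinct [q, q', r, r']" using c(5,6,8) ws ys by auto
    moreover have "{q, q', r, r'} \<subseteq> set zs" using c(7) ws ys by auto
    ultimately show ?thesis by blast
  qed
  obtain p p' q q' r r' ws where pqr: "([p, p'], ws) \<in> set (csplit 2 bs)" "([q, q'], [r, r']) \<in> set (csplit 2 ws)"
     "P = {h p, h p'}" "Q = {h q, h q'}" "R = {h r, h r'}" "distinct [p, p', q, q', r, r']"
     "{p, p', q, q', r, r'} \<subseteq> set bs"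
  proof -
    define ys ws where "ys = filter (\<lambda>z. h z \<in> P) bs" and "ws = filter (\<lambda>z. h z \<notin> P) bs"
    have "P \<subseteq> h ` set bs" using PQR by auto
    note c = csplit_image[OF h(1) ab(6) this, folded ys_def ws_def]
    obtain p p' where ys: "ys = [p, p']" using length_2_ex c(2) cd(1) by metis
    have "h ` set ws = Q \<union> R" using c(4) PQR cd by auto
    from two[OF c(6) this cd(2,3,9)] obtain q q' r r' where
      qr: "([q, q'], [r, r']) \<in> set (csplit 2 ws)" "Q = {h q, h q'}" "R = {h r, h r'}" "distinct [q, q', r, r']"
      "{q, q', r, r'} \<subseteq> set ws" by blast
    have "distinct [p, p', q, q', r, r']" using qr(4,5) c(5,8) ys by auto
    moreover have "{p, p', q, q', r, r'} \<subseteq> set bs" using qr(5) c(7) ys by auto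
    moreover have "([p, p'], ws) \<in> set (csplit 2 bs)" "P = {h p, h p'}" using c(1,3) ys cd(1) by auto
    ultimately show thesis using that qr(1-3) by blast
  qed
  obtain m n n' k k' vs where mnk: "([m], vs) \<in> set (csplit 1 bs')" "([n, n'], [k, k']) \<in> set (csplit 2 vs)"
     "M = {h x, h m}" "N = {h n, h n'}" "K = {h k, h k'}" "distinct [x, m, n, n', k, k']"
     "{x, m, n, n', k, k'} \<subseteq> set bs"
  proof -
    have db: "distinct bs'" "x \<notin> set bs'" using ab(6) bs by auto
    define ys vs where "ys = filter (\<lambda>z. h z \<in> M - {h x}) bs'" and "vs = filter (\<lambda>z. h z \<notin> M - {h x}) bs'"
    have "M - {h x} \<subseteq> h ` set bs'" using PQR bs by auto
    note c = csplit_image[OF h(1) db(1) this, folded ys_def vs_def]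
    \<comment> \<open>One end of \<open>M\<close> is already fixed as \<open>h x\<close>, so a
      single point is left to choose, which matches \<open>csplit 1\<close>.\<close>
    have c1: "card (M - {h x}) = 1" using cd xM by simp
    then obtain m where ys: "ys = [m]" using c(2) by (auto simp: length_Suc_conv)
    then have "M - {h x} = {h m}" using c(3) by simp
    then have M: "M = {h x, h m}" using xM by auto
    have "h ` set vs = h ` set bs' - {h m}" using c(4) \<open>M - {h x} = {h m}\<close> by simp
    also have "\<dots> = h ` set bs - M" using db(2) bs M inj_image_mem_iff[OF h(1)] by auto
    also have "\<dots> = N \<union> K" using PQR cd by auto
    finally have "h ` set vs = N \<union> K" .
    from two[OF c(6) this cd(5,6,12)] obtain n n' k k' where
      nk: "([n, n'], [k, k']) \<in> set (csplit 2 vs)" "N = {h n, h n'}" "K = {h k, h k'}" "distinct [n, n', k, k']"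
      "{n, n', k, k'} \<subseteq> set vs" by blast
    have "m \<in> set bs'" "set vs \<subseteq> set bs'" "m \<notin> set vs" using c(7,8) ys by auto
    then have "distinct [x, m, n, n', k, k']" "{x, m, n, n', k, k'} \<subseteq> set bs"
      using nk(4,5) db(2) bs by auto
    moreover have "([m], vs) \<in> set (csplit 1 bs')" using c(1) ys c1 by simp
    ultimately show thesis using that nk(1-3) M by blast
  qed
  define Bs where "Bs = inner_list a b c d (p, p') (q, q') (r, r') @ outer_list (x, m) (n, n') (k, k')"
  have Bs: "D' = (graph_of \<circ> relabel h) ` set Bs"
  proof -
    have "D' = inner_blocks (h a) (h b) (h c) (h d) P Q R \<union> outer_blocks M N K"
      using S unfolding presents_def by blast
    also have "\<dots> = (graph_of \<circ> relabel h) ` set Bs"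
      unfolding inner_blocks_def outer_blocks_def Bs_def inner_list_def outer_list_def pqr(3-5) mnk(3-5)
      by (simp add: graph_of_def relabel_def insert_commute)
    finally show ?thesis .
  qed
  have "set as \<inter> set bs = {}" "distinct as" using ab by auto
  then have proper': "proper B" if "B \<in> set Bs" for B
    using that pqr(6,7) mnk(6,7) as
    unfolding Bs_def inner_list_def outer_list_def proper_def by auto
  have len: "length Bs = card D'" using E.card_D by (simp add: Bs_def inner_list_def outer_list_def)
  obtain s t where st: "profile (table form) Bs = (s, t)" by (cases "profile (table form) Bs") auto
  have "(as, bs) \<in> set (csplit 4 pts)" using ab(1) E.card_core by simp
  then have "check_core (table form) (as, bs)" using check check_cores_mem by blast
  then have "sums_feasible (inner_profiles (table form) a b c d bs) (outer_profiles (table form) bs)" using as by simp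
  from sums_feasible_mem[OF this inner_profiles_mem[OF pqr(1,2)], of "profile (table form) (outer_list (x, m) (n, n') (k, k'))"]
  have "feasible s t"
    using outer_profiles_mem[OF mnk(1,2)] st bs unfolding Bs_def by (simp add: profile_append)
  moreover have "card (D \<inter> D') = s \<and> card (tris D \<inter> tris D') = t + 2 * s"
    using profile_design[OF D D' X(1) Bs len proper' h(1), of "table form"] st
      table_tris[OF h(1) proper] form by blast
  ultimately show ?thesis by blast
qed

lemma check_form1: "check_cores (table form1) (csplit 4 pts)" by code_simp
lemma check_form2: "check_cores (table form2) (csplit 4 pts)" by code_simp
lemma check_form3: "check_cores (table form3) (csplit 4 pts)" by code_simp

lemma proper_forms: "list_all proper (form1 @ form2 @ form3)"
  by (simp add: form1_def form2_def form3_def pts_def inner_list_def outer_list_def proper_def)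

lemma common_feasible:
  assumes X: "finite X" "card X = 10" and D: "k4e_design X D" and D': "k4e_design X D'"
  shows "\<exists>s t. feasible s t \<and> card (D \<inter> D') = s \<and> card (tris D \<inter> tris D') = t + 2 * s"
proof -
  interpret design10 X D by unfold_locales (use X D in auto)
  obtain a b c d p p' q q' r r' where dist: "distinct [a, b, c, d, p, p', q, q', r, r']"
    and Xeq: "X = {a, b, c, d, p, p', q, q', r, r'}"
    and form: "\<exists>(M, N, K) \<in> {({p,p'}, {q,q'}, {r,r'}), ({p,p'}, {q,r}, {q',r'}), ({p,q}, {p',r}, {q',r'})}.
       D = inner_blocks a b c d {p,p'} {q,q'} {r,r'} \<union> outer_blocks M N K"
    using design_normal_form unfolding normal_form_def by blast
  \<comment> \<open>Naming the points of the normal form by \<open>pt\<close> turns \<open>D\<close>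
    into the image of one of the three forms.\<close>
  define h where "h = case_pt a b c d p p' q q' r r'"
  have h: "inj h"
  proof (rule injI)
    fix x y assume "h x = h y"
    then show "x = y" using dist by (cases x; cases y; simp add: h_def)
  qed
  have "range h = h ` set pts" by (simp add: set_pts)
  then have range: "range h = X" by (simp add: Xeq pts_def h_def)
  have "\<exists>f \<in> {form1, form2, form3}. D = (graph_of \<circ> relabel h) ` set f"
    using form
    by (auto simp: form1_def form2_def form3_def pts_def inner_list_def outer_list_def h_def graph_of_def
        relabel_def inner_blocks_def outer_blocks_def insert_commute)
  then obtain f where f: "f \<in> {form1, form2, form3}" "D = (graph_of \<circ> relabel h) ` set f" by blast
  have "proper B" if "B \<in> set f" for B
    using proper_forms f(1) that by (auto simp: list_all_iff)
  moreover have "check_cores (table f) (csplit 4 pts)" using f(1) check_form1 check_form2 check_form3 by auto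
  ultimately show ?thesis using feasible_profile[OF h range D f(2) _ _ D'] by blast
qed

section \<open>Designs realizing the feasible pairs\<close>

definition covers :: "'a \<Rightarrow> 'a \<Rightarrow> 'a blk \<Rightarrow> bool" where
  "covers x y = (\<lambda>((a, b), (c, d)). same_pair x y a b \<or> same_pair x y a c \<or> same_pair x y a d \<or>
     same_pair x y b c \<or> same_pair x y b d)"

definition cover_count :: "'a blk list \<Rightarrow> 'a \<Rightarrow> 'a \<Rightarrow> nat" where
  "cover_count Bs x y = length (filter (covers x y) Bs)"

text \<open>Every design of order 10 has nine blocks, so the length excludes repetitions, as
  \<open>profile_design\<close> demands.\<close>

definition pt_design :: "pt blk list \<Rightarrow> bool" where
  "pt_design Bs \<longleftrightarrow> list_all proper Bs \<and> length Bs = 9 \<and>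
     list_all (\<lambda>x. list_all (\<lambda>y. x = y \<or> cover_count Bs x y = 1) pts) pts"

lemma covers_iff:
  assumes "inj h" "x \<noteq> y"
  shows "covers x y B \<longleftrightarrow> {h x, h y} \<in> graph_of (relabel h B)"
proof -
  obtain a b c d where B: "B = ((a, b), (c, d))" by (cases B) auto
  have e: "same_pair x y u v \<longleftrightarrow> {h x, h y} = {h u, h v}" for u v
    using assms by (auto simp: same_pair_iff doubleton_eq_iff dest: injD)
  show ?thesis
    unfolding B by (simp add: covers_def e graph_of_def relabel_def kblock_eq_kgraph[symmetric] kblock_def)
qed

lemma k4e_design_pt:
  assumes h: "inj h" and Bs: "pt_design Bs"
  shows "k4e_design (range h) ((graph_of \<circ> relabel h) ` set Bs)"
  unfolding k4e_design_def
proof (intro conjI ballI impI)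
  fix G assume "G \<in> (graph_of \<circ> relabel h) ` set Bs"
  then obtain a b c d where B: "((a, b), (c, d)) \<in> set Bs" and G: "G = kblock (h a) (h b) (h c) (h d)"
    by (auto simp: graph_of_def relabel_def kblock_eq_kgraph)
  then have "distinct [a, b, c, d]" using Bs unfolding pt_design_def list_all_iff proper_def by fastforce
  then have "distinct [h a, h b, h c, h d]" using inj_eq[OF h] by simp
  then show "is_block G" "\<Union>G \<subseteq> range h" unfolding is_block_def G by (blast, auto simp: kblock_def)
next
  fix u v assume "u \<in> range h" "v \<in> range h" "u \<noteq> v"
  then obtain x y where uv: "u = h x" "v = h y" "x \<noteq> y" by auto
  have "x \<in> set pts" "y \<in> set pts" by (simp_all add: set_pts)
  then have "length (filter (covers x y) Bs) = 1"
    using Bs uv(3) unfolding pt_design_def list_all_iff cover_count_def by blast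
  \<comment> \<open>A count of one singles out one list entry, which gives existence and uniqueness
    of the block at the same time.\<close>
  then obtain B where "filter (covers x y) Bs = [B]" by (auto simp: length_Suc_conv)
  then have "set (filter (covers x y) Bs) = {B}" by simp
  then have B: "C \<in> set Bs \<and> {h x, h y} \<in> graph_of (relabel h C) \<longleftrightarrow> C = B" for C
    using covers_iff[OF h uv(3)] by auto
  show "\<exists>!G. G \<in> (graph_of \<circ> relabel h) ` set Bs \<and> {u, v} \<in> G"
    unfolding uv(1,2)
  proof (rule ex1I[of _ "(graph_of \<circ> relabel h) B"])
    show "(graph_of \<circ> relabel h) B \<in> (graph_of \<circ> relabel h) ` set Bs \<and> {h x, h y} \<in> (graph_of \<circ> relabel h) B"
      using B[of B] by simp
    fix G assume "G \<in> (graph_of \<circ> relabel h) ` set Bs \<and> {h x, h y} \<in> G"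
    then obtain C where "C \<in> set Bs" "G = graph_of (relabel h C)" "{h x, h y} \<in> G" by auto
    then show "G = (graph_of \<circ> relabel h) B" using B[of C] by simp
  qed
qed

text \<open>Found by computer search: the \<open>i\<close>-th design meets \<^const>\<open>form2\<close> in the \<open>i\<close>-th entry of the
  spectrum below.\<close>

definition partners :: "(pt list \<times> pt list) list" where
  "partners =
  [([P0,P1,P2,P3,P6,P7,P8,P9,P4,P5], [P4,P5,P7,P9,P6,P8]),
   ([P0,P1,P2,P4,P3,P6,P8,P9,P5,P7], [P3,P5,P7,P9,P6,P8]),
   ([P0,P1,P2,P3,P4,P6,P8,P9,P5,P7], [P4,P5,P7,P9,P6,P8]),
   ([P0,P1,P2,P3,P6,P7,P8,P9,P4,P5], [P4,P6,P5,P7,P8,P9]),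
   ([P0,P1,P2,P3,P4,P6,P5,P8,P7,P9], [P4,P5,P7,P9,P6,P8]),
   ([P0,P1,P2,P3,P4,P6,P8,P9,P5,P7], [P4,P6,P5,P7,P8,P9]),
   ([P0,P1,P2,P3,P4,P6,P5,P8,P7,P9], [P4,P5,P6,P7,P8,P9]),
   ([P0,P1,P2,P3,P4,P6,P5,P8,P7,P9], [P4,P6,P5,P7,P8,P9]),
   ([P0,P1,P2,P3,P4,P6,P7,P8,P5,P9], [P4,P5,P6,P7,P8,P9]),
   ([P0,P1,P2,P3,P4,P6,P7,P8,P5,P9], [P4,P6,P5,P7,P8,P9]),
   ([P0,P1,P2,P4,P6,P7,P3,P5,P8,P9], [P3,P5,P7,P9,P6,P8]),
   ([P0,P1,P2,P4,P6,P7,P3,P5,P8,P9], [P3,P5,P6,P7,P8,P9]),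
   ([P0,P1,P2,P4,P3,P6,P5,P7,P8,P9], [P3,P5,P7,P9,P6,P8]),
   ([P0,P1,P2,P4,P3,P5,P8,P9,P6,P7], [P3,P5,P6,P8,P7,P9]),
   ([P0,P1,P2,P4,P3,P6,P5,P7,P8,P9], [P3,P6,P5,P7,P8,P9]),
   ([P0,P1,P2,P4,P3,P5,P6,P8,P7,P9], [P3,P5,P6,P8,P7,P9]),
   ([P0,P1,P6,P8,P4,P5,P2,P7,P3,P9], [P2,P3,P4,P7,P5,P9]),
   ([P0,P1,P6,P9,P4,P8,P2,P5,P3,P7], [P2,P3,P4,P5,P7,P8]),
   ([P0,P1,P2,P3,P4,P5,P8,P9,P6,P7], [P4,P5,P7,P9,P6,P8]),
   ([P0,P1,P2,P4,P6,P7,P3,P5,P8,P9], [P3,P5,P6,P8,P7,P9]),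
   ([P0,P1,P2,P3,P4,P5,P8,P9,P6,P7], [P4,P5,P6,P7,P8,P9]),
   ([P0,P1,P2,P3,P4,P5,P8,P9,P6,P7], [P4,P6,P5,P7,P8,P9]),
   ([P0,P1,P2,P3,P4,P5,P6,P8,P7,P9], [P4,P5,P7,P9,P6,P8]),
   ([P0,P1,P6,P9,P4,P5,P2,P7,P3,P8], [P2,P3,P4,P5,P7,P8]),
   ([P0,P1,P2,P3,P4,P5,P6,P8,P7,P9], [P4,P5,P6,P7,P8,P9]),
   ([P0,P1,P2,P3,P4,P5,P6,P8,P7,P9], [P4,P6,P5,P7,P8,P9]),
   ([P0,P1,P2,P3,P6,P7,P8,P9,P4,P5], [P4,P5,P6,P8,P7,P9]),
   ([P0,P1,P2,P3,P4,P6,P8,P9,P5,P7], [P4,P5,P6,P8,P7,P9]),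
   ([P0,P1,P2,P4,P3,P5,P6,P7,P8,P9], [P3,P5,P6,P8,P7,P9]),
   ([P0,P1,P2,P3,P4,P6,P5,P8,P7,P9], [P4,P5,P6,P8,P7,P9]),
   ([P0,P1,P2,P3,P4,P6,P7,P8,P5,P9], [P4,P5,P6,P8,P7,P9]),
   ([P0,P1,P7,P9,P4,P5,P3,P6,P2,P8], [P2,P3,P4,P5,P6,P8]),
   ([P0,P1,P7,P9,P4,P5,P2,P3,P6,P8], [P2,P3,P4,P5,P6,P8]),
   ([P0,P1,P7,P9,P4,P5,P2,P6,P3,P8], [P2,P3,P4,P5,P6,P8]),
   ([P0,P1,P2,P3,P4,P5,P8,P9,P6,P7], [P4,P5,P6,P8,P7,P9]),
   ([P0,P1,P2,P3,P4,P5,P6,P8,P7,P9], [P4,P5,P6,P8,P7,P9]),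
   ([P0,P1,P2,P3,P4,P5,P6,P7,P8,P9], [P4,P5,P7,P9,P6,P8]),
   ([P0,P1,P2,P3,P4,P5,P6,P7,P8,P9], [P4,P5,P6,P7,P8,P9]),
   ([P0,P1,P2,P3,P4,P5,P6,P7,P8,P9], [P4,P6,P5,P7,P8,P9]),
   ([P0,P1,P2,P3,P4,P5,P6,P7,P8,P9], [P4,P5,P6,P8,P7,P9])]"

definition spectrum :: "(nat \<times> nat) list" where
  "spectrum = filter (\<lambda>(s, t). feasible s t) (List.product [0..<10] [0..<10])"

lemma lookup_in: "lookup e xs n \<in> insert e (set xs)"
  by (induction xs arbitrary: n) (auto split: nat.split)

lemma lookup_default: "length xs \<le> n \<Longrightarrow> lookup e xs n = e"
  by (induction xs arbitrary: n) (auto split: nat.split)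

lemma set_spectrum: "set spectrum = {(s, t). s < 10 \<and> t < 10 \<and> feasible s t}"
  unfolding spectrum_def set_filter set_product set_upt by auto

text \<open>There are ten rows of at most ten entries, so outside the 10 by 10 window
  \<open>lookup\<close> returns its default and \<open>feasible\<close> is false.\<close>

lemma feasible_iff: "feasible s t \<longleftrightarrow> (s, t) \<in> set spectrum"
proof (cases "s < 10 \<and> t < 10")
  case True
  then show ?thesis by (auto simp: set_spectrum)
next
  case False
  have "\<forall>r\<in>insert [] (set feasible_rows). length r \<le> 10" by (simp add: feasible_rows_def)
  then have "length (lookup [] feasible_rows s) \<le> 10" using lookup_in by (rule bspec)
  then have "\<not> feasible s t" if "\<not> t < 10" using that by (simp add: feasible_def lookup_default)
  moreover have "length feasible_rows = 10" by (simp add: feasible_rows_def)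
  then have "\<not> feasible s t" if "\<not> s < 10"
    using that by (simp add: feasible_def lookup_default)
  ultimately show ?thesis using False by (auto simp: set_spectrum)
qed

lemma partners_design: "list_all pt_design (map blocks_of partners)" by code_simp

text \<open>With \<open>form2\<close> as the first design every feasible pair is attained, so one
  isomorphism type suffices on that side.\<close>

lemma partners_profile: "map (profile (table form2)) (map blocks_of partners) = spectrum" by code_simp

lemma form2_design: "pt_design form2" by code_simp

lemma Fin_10: "Fin 10 = set spectrum"
proof (intro equalityI subsetI)
  fix z assume "z \<in> Fin 10"
  then obtain s t X D D' where z: "z = (s, t)" and X: "finite X" "card X = 10"
    and D: "k4e_design (X :: nat set) D" "k4e_design X D'"
    and st: "card (D \<inter> D') = s" "card (tris D \<inter> tris D') = t + 2 * s"
    unfolding Fin_def by auto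
  then have "feasible s t" using common_feasible[OF X D] by auto
  then show "z \<in> set spectrum" using z feasible_iff by simp
next
  fix z assume "z \<in> set spectrum"
  then have "z \<in> set (map (profile (table form2)) (map blocks_of partners))" using partners_profile by simp
  then obtain w where w: "w \<in> set partners" "z = profile (table form2) (blocks_of w)" by auto
  \<comment> \<open>\<open>Fin\<close> asks for vertex sets of natural numbers.\<close>
  define h :: "pt \<Rightarrow> nat" where "h = case_pt 0 1 2 3 4 5 6 7 8 9"
  have h: "inj h"
  proof (rule injI)
    fix x y assume "h x = h y"
    then show "x = y" by (cases x; cases y; simp add: h_def)
  qed
  let ?D = "(graph_of \<circ> relabel h) ` set form2" and ?D' = "(graph_of \<circ> relabel h) ` set (blocks_of w)"
  have w': "pt_design (blocks_of w)" using partners_design w(1) by (auto simp: list_all_iff)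
  have D: "k4e_design (range h) ?D" "k4e_design (range h) ?D'"
    using k4e_design_pt[OF h] form2_design w' by auto
  have X: "finite (range h)" "card (range h) = 10"
  proof -
    have "range h = h ` set pts" by (simp add: set_pts)
    then show "finite (range h)" "card (range h) = 10" by (simp_all add: pts_def h_def)
  qed
  interpret E: design10 "range h" ?D' by unfold_locales (use X D in auto)
  have proper: "proper B" if "B \<in> set form2" for B
    using form2_design that by (auto simp: pt_design_def list_all_iff)
  have "length (blocks_of w) = card ?D'" using w' E.card_D by (simp add: pt_design_def)
  moreover have "proper B" if "B \<in> set (blocks_of w)" for B
    using w' that by (auto simp: pt_design_def list_all_iff)
  ultimately have "card (?D \<inter> ?D') = fst z \<and> card (tris ?D \<inter> tris ?D') = snd z + 2 * fst z"
    using profile_design[OF D X(1) refl _ _ h, of "table form2" "fst z" "snd z"]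
      table_tris[OF h proper] w(2) by auto
  then show "z \<in> Fin 10"
    unfolding Fin_def using X D by (cases z) auto
qed

text \<open>By \<open>common_feasible\<close> the number of common triangles is at least twice the
  number of common blocks, so every pair of designs has some \<open>t\<close>, and both sets are
  images of \<open>Fin 10\<close>.\<close>

lemma J_10: "J 10 = fst ` Fin 10" and JT_10: "JT 10 = (\<lambda>(s, t). t + 2 * s) ` Fin 10"
proof -
  have ex: "\<exists>t. card (tris D \<inter> tris D') = t + 2 * card (D \<inter> D')"
    if "finite X" "card X = 10" "k4e_design X D" "k4e_design X D'" for X :: "nat set" and D D'
    using common_feasible[OF that] by auto
  show "J 10 = fst ` Fin 10"
  proof (intro equalityI subsetI)
    fix s assume "s \<in> J 10"
    then obtain X D D' where "finite X" "card X = 10" "k4e_design (X :: nat set) D" "k4e_design X D'" "card (D \<inter> D') = s"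
      unfolding J_def by auto
    moreover from this obtain t where "card (tris D \<inter> tris D') = t + 2 * s" using ex by blast
    ultimately have "(s, t) \<in> Fin 10" unfolding Fin_def by blast
    then show "s \<in> fst ` Fin 10" by force
  next
    fix s assume "s \<in> fst ` Fin 10"
    then obtain t where "(s, t) \<in> Fin 10" by auto
    then show "s \<in> J 10" unfolding Fin_def J_def by blast
  qed
  show "JT 10 = (\<lambda>(s, t). t + 2 * s) ` Fin 10"
  proof (intro equalityI subsetI)
    fix n assume "n \<in> JT 10"
    then obtain X D D' where D: "finite X" "card X = 10" "k4e_design (X :: nat set) D" "k4e_design X D'"
       "card (tris D \<inter> tris D') = n"
      unfolding JT_def by auto
    then obtain t where "n = t + 2 * card (D \<inter> D')" using ex by blast
    moreover from this have "(card (D \<inter> D'), t) \<in> Fin 10" unfolding Fin_def using D by blast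
    ultimately show "n \<in> (\<lambda>(s, t). t + 2 * s) ` Fin 10" by force
  next
    fix n assume "n \<in> (\<lambda>(s, t). t + 2 * s) ` Fin 10"
    then obtain s t where "(s, t) \<in> Fin 10" "n = t + 2 * s" by auto
    then show "n \<in> JT 10" unfolding Fin_def JT_def by blast
  qed
qed

theorem theorem4p4:
  shows "Fin 10 = Adm 10 - {(1,8),(3,1),(3,5),(4,1),(4,3),(5,1),(5,2)}"
proof -
  have spec: "set spectrum = {(0,0),(0,1),(0,2),(0,3),(0,4),(0,5),(0,6),(0,7),(0,8),(0,9),
     (1,0),(1,1),(1,2),(1,3),(1,4),(1,5),(1,6),(1,7), (2,0),(2,1),(2,2),(2,3),(2,4),(2,5),(2,6),(2,7),
     (3,0),(3,2),(3,3),(3,4),(3,6), (4,0),(4,2),(4,4), (5,0),(5,4), (6,0),(6,2),(6,3), (9,0)}"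
    by code_simp
  \<comment> \<open>The sets entering \<open>Adm 10\<close> are computed from the spectrum and not
    assumed.\<close>
  have J: "J 10 = {0, 1, 2, 3, 4, 5, 6, 9}" unfolding J_10 Fin_10 spec by code_simp
  have JT: "JT 10 = {0, 1, 2, 3, 4, 5, 6, 7, 8, 9, 10, 11, 12, 14, 15, 18}" unfolding JT_10 Fin_10 spec by code_simp
  show ?thesis
  proof (intro equalityI subsetI)
    fix z assume "z \<in> Fin 10"
    then show "z \<in> Adm 10 - {(1,8),(3,1),(3,5),(4,1),(4,3),(5,1),(5,2)}"
      unfolding Adm_def J JT Fin_10 spec bnum_def by (elim insertE emptyE) simp_all
  next
    fix z assume "z \<in> Adm 10 - {(1,8),(3,1),(3,5),(4,1),(4,3),(5,1),(5,2)}"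
    then obtain s t where z: "z = (s, t)" and adm: "(s, t) \<in> Adm 10"
      and ex: "(s, t) \<notin> {(1,8),(3,1),(3,5),(4,1),(4,3),(5,1),(5,2)}" by (metis DiffE surj_pair)
    have st: "s + t \<le> 9" "s \<in> {0, 1, 2, 3, 4, 5, 6, 9}"
      "t + 2 * s \<in> {0, 1, 2, 3, 4, 5, 6, 7, 8, 9, 10, 11, 12, 14, 15, 18}"
      using adm by (simp_all only: Adm_def mem_Collect_eq prod.case J JT) (simp add: bnum_def)
    \<comment> \<open>The bound \<open>s + t \<le> 9\<close> leaves finitely many pairs, which are
      compared with the spectrum one by one.\<close>
    have "t \<in> {0, 1, 2, 3, 4, 5, 6, 7, 8, 9}" using st(1) by auto
    with st(2) show "z \<in> Fin 10"
      unfolding Fin_10 spec z by (elim insertE emptyE) (use st(1,3) ex in simp_all)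
  qed
qed

end
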